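(* Let $n=2$, and let $q,t,s_1,s_2$ be fixed generic complex parameters with $|q|<1$ and $|qt^{-1}|<1$. Then for all (generic) $\alpha,\beta\in\mathbb{C}$ the integral transformations $I(\alpha)=I(\alpha;s_1,s_2,q,t)$ and $I(\beta)=I(\beta;s_1,s_2,q,t)$ commute on $\mathcal{F}_2$: $$I(\alpha)I(\beta)=I(\beta)I(\alpha).$$
   Context: Notation: $(a;q)_\infty=\prod_{k\ge 0}(1-aq^k)$ and $\Theta_q(z)=(z;q)_\infty(q/z;q)_\infty(q;q)_\infty$. Put $$h(\zeta)=(1-\zeta)\frac{(qt^{-1}\zeta;q)_\infty}{(t\zeta;q)_\infty},\qquad g(\zeta)=\frac{(q^{1/2}t^{1/2}\zeta;q)_\infty}{(q^{1/2}t^{-1/2}\zeta;q)_\infty}$$ (with fixed square roots of $q$ and $t$). $\mathcal{F}_2$ is the space of formal power series $\sum_{j\ge 0}f_j(\zeta_2/\zeta_1)^j$ with complex coefficients. The operator $I(\alpha)$ on $\mathcal{F}_2$ is $$I(\alpha)f(\zeta_1,\zeta_2)=\prod_{i=1}^2\left(\frac{(qt^{-1};q)_\infty}{(\alpha s_i^{-1}qt^{-1};q)_\infty}\frac{(q;q)_\infty}{(\alpha^{-1}s_iq;q)_\infty}\right)h(\zeta_2/\zeta_1)\oint\oint\frac{d\xi_1}{2\pi i\xi_1}\frac{d\xi_2}{2\pi i\xi_2}\prod_{i=1}^2\frac{\Theta_q(\alpha s_i^{-1}q^{1/2}t^{-1/2}\zeta_i/\xi_i)}{\Theta_q(q^{1/2}t^{-1/2}\zeta_i/\xi_i)}\;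 g(\xi_1/\zeta_1)g(\xi_2/\zeta_1)g(\zeta_2/\xi_1)g(\xi_2/\zeta_2)\,f(\xi_1,\xi_2),$$ with contours $|\zeta_i/\xi_i|=1$. On formal series this is understood as follows: $h(\zeta_2/\zeta_1)$, $g(\xi_2/\zeta_1)$, $g(\zeta_2/\xi_1)$ are expanded as power series in their arguments; each factor $g(\xi_i/\zeta_i)\Theta_q(\alpha s_i^{-1}q^{1/2}t^{-1/2}\zeta_i/\xi_i)/\Theta_q(q^{1/2}t^{-1/2}\zeta_i/\xi_i)$ is expanded as a Laurent series in $\zeta_i/\xi_i$ on the annulus $|q^{1/2}t^{-1/2}|<|\zeta_i/\xi_i|<|q^{-1/2}t^{1/2}|$ (which contains the contour); and $\oint d\xi_i/(2\pi i\xi_i)$ extracts the constant term in $\xi_i$. "Generic" means nonzero and outside a countable union of zero sets of not identically vanishing analytic functions, so that in particular no denominators vanish. *)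

theory Defs
  imports "HOL-Complex_Analysis.Complex_Analysis"
begin

definition qpoch :: "complex \<Rightarrow> complex \<Rightarrow> complex" where
  "qpoch a q = (\<Prod>k. 1 - a * q ^ k)"

definition theta :: "complex \<Rightarrow> complex \<Rightarrow> complex" where
  "theta q z = qpoch z q * qpoch (q / z) q * qpoch q q"

definition h_fun :: "complex \<Rightarrow> complex \<Rightarrow> complex \<Rightarrow> complex" where
  "h_fun q t z = (1 - z) * qpoch (q / t * z) q / qpoch (t * z) q"

text \<open>Throughout, \<open>qh\<close> and \<open>th\<close> are the fixed square roots of \<open>q\<close> and \<open>t\<close>.\<close>

definition g_fun :: "complex \<Rightarrow> complex \<Rightarrow> complex \<Rightarrow> complex \<Rightarrow> complex" where
  "g_fun q qh th z = qpoch (qh * th * z) q / qpoch (qh / th * z) q"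

text \<open>Coefficients of the Laurent expansion on the annulus \<open>r < |w| < R\<close>.
  A quotient of analytic functions has the value \<open>0\<close> wherever its denominator vanishes, even if
  the singularity is removable (such points do occur below: zeros of the denominator theta function
  cancelled by zeros of \<open>g\<close>); \<^const>\<open>remove_sings\<close> restores the analytic function
  that is being expanded.\<close>

definition annulus_laurent_coeffs :: "real \<Rightarrow> real \<Rightarrow> (complex \<Rightarrow> complex) \<Rightarrow> int \<Rightarrow> complex" where
  "annulus_laurent_coeffs r R F =
     (THE c. \<forall>w. r < norm w \<and> norm w < R \<longrightarrow>
               ((\<lambda>n. c n * w powi n) has_sum remove_sings F w) UNIV)"

text \<open>The factor \<open>g(\<xi>\<^sub>i/\<zeta>\<^sub>i) \<Theta>(a x \<zeta>\<^sub>i/\<xi>\<^sub>i) / \<Theta>(x \<zeta>\<^sub>i/\<xi>\<^sub>i)\<close> as a function of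
  \<open>w = \<zeta>\<^sub>i/\<xi>\<^sub>i\<close>, where \<open>x = qh/th\<close> and \<open>a = \<alpha>/s\<^sub>i\<close>.\<close>

definition kern :: "complex \<Rightarrow> complex \<Rightarrow> complex \<Rightarrow> complex \<Rightarrow> complex \<Rightarrow> complex" where
  "kern q qh th a w =
     g_fun q qh th (1 / w) * (theta q (a * (qh / th) * w) / theta q (qh / th * w))"

definition kern_coeff :: "complex \<Rightarrow> complex \<Rightarrow> complex \<Rightarrow> complex \<Rightarrow> int \<Rightarrow> complex" where
  "kern_coeff q qh th a =
     annulus_laurent_coeffs (norm (qh / th)) (norm (th / qh)) (kern q qh th a)"

text \<open>In the product of the five series
  \<open>\<Sum> A\<^sub>m (\<zeta>\<^sub>1/\<xi>\<^sub>1)\<^sup>m\<close>, \<open>\<Sum> B\<^sub>n (\<zeta>\<^sub>2/\<xi>\<^sub>2)\<^sup>n\<close> (bilateral),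
  \<open>\<Sum> C\<^sub>a (\<xi>\<^sub>2/\<zeta>\<^sub>1)\<^sup>a\<close>, \<open>\<Sum> D\<^sub>b (\<zeta>\<^sub>2/\<xi>\<^sub>1)\<^sup>b\<close>, \<open>\<Sum> f\<^sub>j (\<xi>\<^sub>2/\<xi>\<^sub>1)\<^sup>j\<close>,
  \<open>monomial_terms k1 k2 l1 l2\<close> is the set of index tuples \<open>(m, n, a, b, j)\<close> contributing to the
  monomial with exponents \<open>k1, k2\<close> in \<open>\<zeta>\<^sub>1, \<zeta>\<^sub>2\<close> and \<open>l1, l2\<close> in \<open>\<xi>\<^sub>1, \<xi>\<^sub>2\<close>.\<close>

definition monomial_terms :: "int \<Rightarrow> int \<Rightarrow> int \<Rightarrow> int \<Rightarrow> (int \<times> int \<times> nat \<times> nat \<times> nat) set" where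
  "monomial_terms k1 k2 l1 l2 = {(m, n, a, b, j).
     m - int a = k1 \<and> n + int b = k2 \<and>
     - m - int b - int j = l1 \<and> - n + int a + int j = l2}"

lemma finite_monomial_terms: "finite (monomial_terms k1 k2 l1 l2)"
proof (rule finite_subset)
  let ?N = "nat (\<bar>k1\<bar> + \<bar>l1\<bar>)"
  show "monomial_terms k1 k2 l1 l2 \<subseteq>
          (\<lambda>(a, b, j). (k1 + int a, k2 - int b, a, b, j)) ` ({..?N} \<times> {..?N} \<times> {..?N})"
  proof
    fix p assume "p \<in> monomial_terms k1 k2 l1 l2"
    then obtain m n a b j where p: "p = (m, n, a, b, j)"
      and *: "m - int a = k1" "n + int b = k2" "- m - int b - int j = l1"
      by (auto simp: monomial_terms_def)
    have "p = (\<lambda>(a, b, j). (k1 + int a, k2 - int b, a, b, j)) (a, b, j)"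
      using p * by auto
    moreover have "(a, b, j) \<in> {..?N} \<times> {..?N} \<times> {..?N}"
      using * by auto
    ultimately show "p \<in> (\<lambda>(a, b, j). (k1 + int a, k2 - int b, a, b, j)) `
                            ({..?N} \<times> {..?N} \<times> {..?N})"
      by (rule image_eqI)
  qed
qed simp

definition product_coeff ::
  "(int \<Rightarrow> complex) \<Rightarrow> (int \<Rightarrow> complex) \<Rightarrow> complex fps \<Rightarrow> complex fps \<Rightarrow> complex fps \<Rightarrow>
   int \<Rightarrow> int \<Rightarrow> int \<Rightarrow> int \<Rightarrow> complex" where
  "product_coeff A B C D f k1 k2 l1 l2 =
     (\<Sum>(m, n, a, b, j) \<in> monomial_terms k1 k2 l1 l2.
        A m * B n * fps_nth C a * fps_nth D b * fps_nth f j)"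

text \<open>The part of the product that is constant in \<open>\<xi>\<^sub>1, \<xi>\<^sub>2\<close> is a power series in
  \<open>\<zeta>\<^sub>2/\<zeta>\<^sub>1\<close>.\<close>

lemma constant_term_exponents:
  assumes "monomial_terms k1 k2 0 0 \<noteq> {}"
  shows "k2 \<ge> 0 \<and> k1 = - k2"
  using assms by (auto simp: monomial_terms_def)

definition I_prefactor :: "complex \<Rightarrow> complex \<Rightarrow> complex \<Rightarrow> complex \<Rightarrow> complex" where
  "I_prefactor q t s \<alpha> =
     qpoch (q / t) q / qpoch (\<alpha> / s * (q / t)) q * (qpoch q q / qpoch (s / \<alpha> * q) q)"

text \<open>The series \<open>\<Sum> f\<^sub>j (\<zeta>\<^sub>2/\<zeta>\<^sub>1)\<^sup>j\<close> is represented by the formal power series with coefficients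
  \<open>f\<^sub>j\<close>.  The factors \<open>g(\<xi>\<^sub>i/\<zeta>\<^sub>i)\<close> of the integrand are part of \<^const>\<open>kern\<close>.\<close>

definition I_op :: "complex \<Rightarrow> complex \<Rightarrow> complex \<Rightarrow> complex \<Rightarrow> complex \<Rightarrow> complex \<Rightarrow> complex \<Rightarrow>
    complex fps \<Rightarrow> complex fps" where
  "I_op q t qh th s1 s2 \<alpha> f =
     fps_const (I_prefactor q t s1 \<alpha> * I_prefactor q t s2 \<alpha>) *
     fps_expansion (h_fun q t) 0 *
     Abs_fps (\<lambda>m. product_coeff
       (kern_coeff q qh th (\<alpha> / s1)) (kern_coeff q qh th (\<alpha> / s2))
       (fps_expansion (g_fun q qh th) 0) (fps_expansion (g_fun q qh th) 0) f
       (- int m) (int m) 0 0)"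

text \<open>Genericity: the parameters are nonzero and the denominators in the definition of
  \<open>I(\<alpha>)\<close> that depend on \<open>\<alpha>\<close> do not vanish.\<close>

definition generic_alpha :: "complex \<Rightarrow> complex \<Rightarrow> complex \<Rightarrow> complex \<Rightarrow> complex \<Rightarrow> bool" where
  "generic_alpha q t s1 s2 \<alpha> \<longleftrightarrow> \<alpha> \<noteq> 0 \<and>
     (\<forall>s \<in> {s1, s2}. qpoch (\<alpha> / s * (q / t)) q \<noteq> 0 \<and> qpoch (s / \<alpha> * q) q \<noteq> 0)"

end

theory Submission
  imports Defs
begin

text \<open>
  Put \<open>x = q\<^sup>1\<^sup>/\<^sup>2t\<^sup>-\<^sup>1\<^sup>/\<^sup>2\<close>. The Laurent coefficients \<open>c\<^sub>n\<close> of the kernel satisfy a two-term recurrence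
  (in effect Ramanujan's summation of the \<open>1\<psi>1\<close> series), so up to scalars \<open>I(\<alpha>)\<close> is multiplication by \<open>h\<close>
  after an explicit lower triangular matrix \<open>K\<close> with terminating sums as entries. A termwise
  identity for these sums shows that \<open>hK\<close> commutes with a second order \<open>q\<close>-difference operator of
  Macdonald type, which depends on \<open>s\<^sub>1/s\<^sub>2\<close> but not on \<open>\<alpha>\<close> and is lower triangular with diagonal
  entries \<open>q\<^sup>-\<^sup>m + (s\<^sub>1/s\<^sub>2) q\<^sup>m\<close>. When these are pairwise distinct, any two lower triangular operators
  that commute with it commute with each other. The remaining values of \<open>s\<^sub>1\<close> follow by
  continuity, because the matrix entries are rational functions of \<open>s\<^sub>1\<close>.
\<close>

section \<open>The infinite \<open>q\<close>-Pochhammer symbol\<close>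

text \<open>The commuting operator arises in two halves. \<open>K_op\<close> trades the difference
  operator with parameter q/t for the one with parameter t, at the price of a factor 1 - z that sits
  on opposite sides; the quotient part v of h trades it back. Hence (1 - z) v K commutes with D (1 -
  z)^(-1), where D is taken at q/t. Scalars cancel from a commutation relation between linear
  operators, so only ratios of kernel coefficients matter, and the recurrence supplies these. The
  obstacle is that genericity of \<alpha> and \<beta> keeps the denominators of K away from 0 but
  says nothing about s1/s2: the eigenvalues collide as soon as (s1/s2) q^k = 1 for some k \<ge> 1.
  Moving s1 alone repairs this, because it changes the invariant s1/s2 for both operators
  simultaneously and leaves the parameters \<alpha>/(s2 t) and \<beta>/(s2 t) fixed.\<close>

lemma summable_qpoch:
  fixes a q :: complex
  assumes "norm q < 1"
  shows "summable (\<lambda>k. norm (a * q ^ k))"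
  using assms by (auto simp: norm_mult norm_power intro!: summable_mult summable_geometric)

lemma convergent_prod_qpoch:
  assumes "norm q < 1"
  shows "convergent_prod (\<lambda>k. 1 - a * q ^ k :: complex)"
  by (intro abs_convergent_prod_imp_convergent_prod summable_imp_abs_convergent_prod)
     (use summable_qpoch[OF assms, of a] in simp)

lemma qpoch_step:
  assumes "norm q < 1"
  shows "qpoch a q = (1 - a) * qpoch (a * q) q"
  using has_prod_ignore_initial_segment'[OF convergent_prod_qpoch[OF assms, of a], of 1]
  unfolding qpoch_def by (simp add: has_prod_iff mult.assoc)

lemma qpoch_0 [simp]: "qpoch 0 q = 1"
  by (simp add: qpoch_def)

text \<open>In the sense of \<open>convergent_prod\<close>, nonzero factors cannot produce the limit
  0, so vanishing is decided factor by factor. This makes the genericity assumptions usable.\<close>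

lemma qpoch_nonzero_iff:
  assumes "norm q < 1"
  shows "qpoch a q \<noteq> 0 \<longleftrightarrow> (\<forall>k. a * q ^ k \<noteq> 1)"
proof
  assume "qpoch a q \<noteq> 0"
  moreover have "1 - a * q ^ k = 0 \<Longrightarrow> qpoch a q = 0" for k
    unfolding qpoch_def
    using has_prod_ignore_initial_segment'[OF convergent_prod_qpoch[OF assms, of a], of "Suc k"]
    by (auto simp: has_prod_iff)
  ultimately show "\<forall>k. a * q ^ k \<noteq> 1" by auto
next
  assume "\<forall>k. a * q ^ k \<noteq> 1"
  then show "qpoch a q \<noteq> 0"
    unfolding qpoch_def by (intro prodinf_nonzero convergent_prod_qpoch assms) (metis right_minus_eq)
qed

lemma qpoch_nonzero_ball:
  assumes "norm q < 1" "norm a < 1"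
  shows "qpoch a q \<noteq> 0"
  unfolding qpoch_nonzero_iff[OF assms(1)]
proof
  fix k
  have "norm (a * q ^ k) \<le> norm a * 1"
    unfolding norm_mult norm_power using assms(1)
    by (intro mult_left_mono power_le_one) auto
  with assms(2) show "a * q ^ k \<noteq> 1" by auto
qed

lemma holomorphic_on_qpoch:
  assumes "norm q < 1"
  shows "(\<lambda>a. qpoch a q) holomorphic_on UNIV"
proof (rule holomorphic_uniform_sequence[where f = "\<lambda>n a. \<Prod>k<n. 1 - a * q ^ k"])
  fix x :: complex
  have "uniformly_convergent_on (cball x 1) (\<lambda>N a. \<Prod>k<N. 1 - a * q ^ k)"
  proof (rule uniformly_convergent_on_prod')
    show "uniformly_convergent_on (cball x 1) (\<lambda>N a. \<Sum>k<N. norm (1 - a * q ^ k - 1))"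
    proof (rule Weierstrass_m_test'_ev)
      show "\<forall>\<^sub>F n in sequentially. \<forall>a\<in>cball x 1.
              norm (norm (1 - a * q ^ n - 1)) \<le> norm (of_real (norm x + 1) * q ^ n)"
      proof (intro always_eventually allI ballI)
        fix n a assume "a \<in> cball x 1"
        then have "norm a \<le> norm x + 1"
          using norm_triangle_ineq2[of a x] by (simp add: dist_norm norm_minus_commute)
        then have "norm a * norm q ^ n \<le> (norm x + 1) * norm q ^ n"
          by (rule mult_right_mono) simp
        moreover have "norm (of_real (norm x + 1) :: complex) = norm x + 1"
          by (metis abs_of_nonneg add_nonneg_nonneg norm_ge_zero norm_of_real zero_le_one)
        ultimately show "norm (norm (1 - a * q ^ n - 1)) \<le> norm (of_real (norm x + 1) * q ^ n)"
          by (simp add: norm_mult norm_power)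
      qed
    qed (rule summable_qpoch[OF assms])
  qed (auto intro!: continuous_intros)
  moreover have "lim (\<lambda>N. \<Prod>k<N. 1 - a * q ^ k) = qpoch a q" for a
    unfolding qpoch_def
    by (intro limI has_prod_imp_tendsto' convergent_prod_has_prod convergent_prod_qpoch assms)
  ultimately have "uniform_limit (cball x 1) (\<lambda>N a. \<Prod>k<N. 1 - a * q ^ k) (\<lambda>a. qpoch a q) sequentially"
    by (simp add: uniformly_convergent_uniform_limit_iff)
  then show "\<exists>d>0. cball x d \<subseteq> UNIV \<and>
      uniform_limit (cball x d) (\<lambda>N a. \<Prod>k<N. 1 - a * q ^ k) (\<lambda>a. qpoch a q) sequentially"
    by (intro exI[of _ 1]) auto
qed (auto intro!: holomorphic_intros)

lemma holomorphic_on_qpoch' [holomorphic_intros]: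
  assumes "norm q < 1" "f holomorphic_on S"
  shows "(\<lambda>z. qpoch (f z) q) holomorphic_on S"
  using holomorphic_on_compose_gen[OF assms(2) holomorphic_on_qpoch[OF assms(1)]]
  by (auto simp: o_def)

text \<open>An entire function with value 1 at 0 has isolated zeros. Two density arguments rest on
  this: removing the singularities of the kernel, and moving s1 off an exceptional set.\<close>

lemma eventually_qpoch_nonzero:
  assumes "norm q < 1"
  shows "\<forall>\<^sub>F y in at a. qpoch y q \<noteq> 0"
proof (cases "qpoch a q = 0")
  case True
  obtain r where r: "0 < r" "\<And>z. z \<in> ball a r - {a} \<Longrightarrow> qpoch z q \<noteq> 0"
    by (rule isolated_zeros[OF holomorphic_on_qpoch[OF assms], of a 0]) (use True in auto)
  then show ?thesis
    unfolding eventually_at by (intro exI[of _ r]) (auto simp: dist_commute)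
next
  case False
  have "isCont (\<lambda>a. qpoch a q) a"
    using holomorphic_on_imp_continuous_on[OF holomorphic_on_qpoch[OF assms]]
    by (simp add: continuous_on_eq_continuous_at)
  then show ?thesis
    using False by (intro tendsto_imp_eventually_ne) (auto simp: isCont_def)
qed

section \<open>First-order q-difference equations of q-Pochhammer quotients\<close>

lemma qpoch_quotient_step:
  assumes "norm q < 1" "b * w \<noteq> 1"
  shows "(1 - a * w) * (qpoch (a * (q * w)) q / qpoch (b * (q * w)) q) =
         (1 - b * w) * (qpoch (a * w) q / qpoch (b * w) q)"
proof -
  have step: "qpoch (c * w) q = (1 - c * w) * qpoch (c * (q * w)) q" for c
    using qpoch_step[OF assms(1), of "c * w"] by (simp add: mult_ac)
  show ?thesis
    unfolding step[of a] step[of b] using assms(2) by simp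
qed

lemma holomorphic_on_qpoch_quotient:
  assumes "norm q < 1" "\<And>w. w \<in> S \<Longrightarrow> norm (b * w) < 1"
  shows "(\<lambda>w. qpoch (a * w) q / qpoch (b * w) q) holomorphic_on S"
  using assms(2) by (intro holomorphic_intros assms(1) qpoch_nonzero_ball)

lemma has_fps_expansion_qpoch_quotient:
  assumes "norm q < 1"
  shows "(\<lambda>w. qpoch (a * w) q / qpoch (b * w) q) has_fps_expansion
           fps_expansion (\<lambda>w. qpoch (a * w) q / qpoch (b * w) q) 0"
proof (rule has_fps_expansion_fps_expansion)
  show "open {w. norm (b * w) < 1}"
    by (intro open_Collect_less continuous_intros)
qed (auto intro: holomorphic_on_qpoch_quotient[OF assms])

text \<open>The functional equation holds near 0 and so passes to the series. Applied to
  \<open>g\<close> it yields the coefficients; applied to the quotient inside \<open>h\<close> it is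
  the hypothesis of \<open>D_op_mult\<close>.\<close>

lemma fps_qpoch_quotient_step:
  fixes a b q :: complex
  defines "F \<equiv> fps_expansion (\<lambda>w. qpoch (a * w) q / qpoch (b * w) q) 0"
  assumes "norm q < 1"
  shows "(1 - fps_const b * fps_X) * F = (1 - fps_const a * fps_X) * (F oo (fps_const q * fps_X))"
proof -
  define \<phi> where "\<phi> = (\<lambda>w. qpoch (a * w) q / qpoch (b * w) q)"
  have F: "\<phi> has_fps_expansion F"
    unfolding F_def \<phi>_def by (rule has_fps_expansion_qpoch_quotient[OF assms(2)])
  have "(\<phi> \<circ> (\<lambda>w. q * w)) has_fps_expansion (F oo (fps_const q * fps_X))"
    by (intro has_fps_expansion_compose F fps_expansion_intros) auto
  then have 1: "(\<lambda>w. (1 - a * w) * \<phi> (q * w)) has_fps_expansion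
      ((1 - fps_const a * fps_X) * (F oo (fps_const q * fps_X)))"
    by (intro fps_expansion_intros) (simp_all add: o_def)
  have "(\<lambda>w. (1 - b * w) * \<phi> w) has_fps_expansion ((1 - fps_const b * fps_X) * F)"
    by (intro fps_expansion_intros F)
  moreover
  have "\<forall>\<^sub>F w in nhds 0. b * w \<noteq> 1"
  proof -
    have "((\<lambda>w. b * w) \<longlongrightarrow> b * 0) (nhds 0)"
      by (intro tendsto_intros filterlim_ident)
    then show ?thesis
      by (rule tendsto_imp_eventually_ne) simp
  qed
  then have "\<forall>\<^sub>F w in nhds 0. (1 - a * w) * \<phi> (q * w) = (1 - b * w) * \<phi> w"
    unfolding \<phi>_def by eventually_elim (rule qpoch_quotient_step[OF assms(2)])
  then have "(\<lambda>w. (1 - b * w) * \<phi> w) has_fps_expansion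
      ((1 - fps_const a * fps_X) * (F oo (fps_const q * fps_X)))"
    using has_fps_expansion_cong[OF _ refl] 1 by fastforce
  ultimately show ?thesis
    by (rule fps_expansion_unique_complex)
qed

text \<open>The q-binomial theorem as a recurrence: for b \<noteq> 0 the coefficients are b^k
  (a/b;q)_k / (q;q)_k.\<close>

lemma fps_qpoch_quotient_nth_Suc:
  fixes a b q :: complex
  defines "F \<equiv> fps_expansion (\<lambda>w. qpoch (a * w) q / qpoch (b * w) q) 0"
  assumes "norm q < 1"
  shows "fps_nth F (Suc k) * (1 - q ^ Suc k) = fps_nth F k * (b - a * q ^ k)"
proof -
  have eq: "(1 - fps_const b * fps_X) * F =
      (1 - fps_const a * fps_X) * (F oo (fps_const q * fps_X))"
    unfolding F_def by (rule fps_qpoch_quotient_step[OF assms(2)])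
  have nth: "fps_nth ((1 - fps_const c * fps_X) * f) (Suc k) = fps_nth f (Suc k) - c * fps_nth f k"
    for c and f :: "complex fps"
    by (simp add: left_diff_distrib mult.assoc)
  have "fps_nth F (Suc k) - b * fps_nth F k =
      q ^ Suc k * fps_nth F (Suc k) - a * (q ^ k * fps_nth F k)"
    using arg_cong[OF eq, of "\<lambda>f. fps_nth f (Suc k)"]
    unfolding nth fps_compose_linear fps_nth_Abs_fps .
  then show ?thesis
    by (simp add: algebra_simps)
qed

section \<open>Laurent series\<close>

lemma holomorphic_on_ball_has_sum:
  assumes "f holomorphic_on ball 0 R"
  obtains c where "\<And>w. norm w < R \<Longrightarrow> (\<lambda>n. norm (c n * w ^ n)) summable_on UNIV"
    and "\<And>w. norm w < R \<Longrightarrow> ((\<lambda>n. c n * w ^ n) has_sum f w) UNIV"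
proof -
  define c where "c n = (deriv ^^ n) f 0 / fact n" for n
  have sums: "(\<lambda>n. c n * w ^ n) sums f w" if "norm w < R" for w
    using holomorphic_power_series[OF assms, of w] that by (simp add: c_def)
  have abs: "summable (\<lambda>n. norm (c n * w ^ n))" if w: "norm w < R" for w
  proof -
    obtain r where r: "norm w < r" "r < R"
      using dense[OF w] by blast
    then have "norm (of_real r :: complex) = r"
      using norm_ge_zero[of w] by (subst norm_of_real) linarith
    then show ?thesis
      using powser_insidea[OF sums_summable[OF sums], of "of_real r" w] r by simp
  qed
  show ?thesis
  proof (rule that)
    fix w :: complex assume "norm w < R"
    then show "(\<lambda>n. norm (c n * w ^ n)) summable_on UNIV"
      by (intro norm_summable_imp_summable_on) (simp add: abs)
    from \<open>norm w < R\<close> show "((\<lambda>n. c n * w ^ n) has_sum f w) UNIV"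
      by (intro norm_summable_imp_has_sum abs sums)
  qed
qed

lemma has_sum_mult_Times:
  fixes f :: "'a \<Rightarrow> complex" and g :: "'b \<Rightarrow> complex"
  assumes "(\<lambda>x. norm (f x)) summable_on A" "(\<lambda>y. norm (g y)) summable_on B"
    and "(f has_sum s) A" "(g has_sum t) B"
  shows "((\<lambda>(x, y). f x * g y) has_sum s * t) (A \<times> B)"
proof (rule has_sum_SigmaI)
  have "(\<lambda>p. norm (case p of (x, y) \<Rightarrow> f x * g y)) summable_on A \<times> B"
  proof (rule Infinite_Sum.abs_summable_on_Sigma_iff[THEN iffD2], intro conjI ballI)
    fix x
    show "(\<lambda>y. norm (case (x, y) of (x, y) \<Rightarrow> f x * g y)) summable_on B"
      using assms(2) by (simp add: norm_mult summable_on_cmult_right)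
  next
    have "(\<lambda>x. norm (f x) * norm (\<Sum>\<^sub>\<infinity>y\<in>B. norm (g y))) summable_on A"
      by (intro summable_on_cmult_left assms(1))
    then show "(\<lambda>x. norm (\<Sum>\<^sub>\<infinity>y\<in>B. norm (case (x, y) of (x, y) \<Rightarrow> f x * g y))) summable_on A"
      by (simp add: norm_mult infsum_cmult_right' abs_mult)
  qed
  then show "(\<lambda>(x, y). f x * g y) summable_on A \<times> B"
    by (rule abs_summable_summable)
  show "((\<lambda>x. f x * t) has_sum s * t) A"
    by (intro has_sum_cmult_left assms)
qed (auto intro!: has_sum_cmult_right assms)

text \<open>Absolute convergence allows the double series to be grouped by n = i - j. Each group is
  itself an infinite series, whose sum up to the factor w^n is free of w.\<close>

lemma laurent_expansion_product:
  assumes P: "P holomorphic_on ball 0 R" and N: "N holomorphic_on ball 0 R'"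
  obtains c where "\<And>w. w \<noteq> 0 \<Longrightarrow> norm w < R \<Longrightarrow> norm (1 / w) < R' \<Longrightarrow>
    ((\<lambda>n. c n * w powi n) has_sum P w * N (1 / w)) UNIV"
proof -
  obtain p where p: "\<And>w. norm w < R \<Longrightarrow> (\<lambda>n. norm (p n * w ^ n)) summable_on UNIV"
      "\<And>w. norm w < R \<Longrightarrow> ((\<lambda>n. p n * w ^ n) has_sum P w) UNIV"
    using holomorphic_on_ball_has_sum[OF P] by metis
  obtain b where b: "\<And>w. norm w < R' \<Longrightarrow> (\<lambda>n. norm (b n * w ^ n)) summable_on UNIV"
      "\<And>w. norm w < R' \<Longrightarrow> ((\<lambda>n. b n * w ^ n) has_sum N w) UNIV"
    using holomorphic_on_ball_has_sum[OF N] by metis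
  \<comment> \<open>These are the i whose partner j = i - n is a natural number, so
    \<open>nat\<close> never truncates below.\<close>
  define I where "I n = {i. int i \<ge> n}" for n
  define c where "c n = (\<Sum>\<^sub>\<infinity>i\<in>I n. p i * b (nat (int i - n)))" for n
  show ?thesis
  proof (rule that)
    fix w :: complex assume w: "w \<noteq> 0" "norm w < R" "norm (1 / w) < R'"
    have "((\<lambda>(i, j). (p i * w ^ i) * (b j * (1 / w) ^ j)) has_sum P w * N (1 / w)) (UNIV \<times> UNIV)"
      by (intro has_sum_mult_Times p b w)
    also have "?this \<longleftrightarrow> ((\<lambda>(n, i). p i * b (nat (int i - n)) * w powi n) has_sum P w * N (1 / w)) (Sigma UNIV I)"
      by (rule has_sum_reindex_bij_witness[where i = "\<lambda>(n, i). (i, nat (int i - n))"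
            and j = "\<lambda>(i, j). (int i - int j, i)"])
         (use w in \<open>auto simp: I_def power_int_diff field_simps\<close>)
    finally have *: "((\<lambda>(n, i). p i * b (nat (int i - n)) * w powi n) has_sum P w * N (1 / w)) (Sigma UNIV I)" .
    show "((\<lambda>n. c n * w powi n) has_sum P w * N (1 / w)) UNIV"
    proof (rule has_sum_SigmaD[OF *])
      fix n
      have "(\<lambda>i. p i * b (nat (int i - n)) * w powi n) summable_on I n"
        by (rule summable_on_SigmaD1[OF has_sum_imp_summable[OF *]]) simp
      then show "((\<lambda>i. case (n, i) of (n, i) \<Rightarrow> p i * b (nat (int i - n)) * w powi n)
                  has_sum c n * w powi n) (I n)"
        unfolding c_def infsum_cmult_left'[symmetric] by simp
    qed
  qed
qed

section \<open>Uniqueness of Laurent coefficients\<close>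

lemma has_contour_integral_powi_circlepath:
  assumes "\<rho> > 0"
  shows "((\<lambda>z. z powi n * z powi (-(m+1))) has_contour_integral
            (if n = m then of_real (2 * pi) * \<i> else 0)) (circlepath 0 \<rho>)"
proof -
  have "(\<lambda>z. z powi n :: complex) has_laurent_expansion fls_X_intpow n"
    by (rule has_laurent_expansion_fps_X_power_int)
  from fls_nth_as_contour_integral[OF this, of "\<rho> + 1" \<rho> m] assms
  show ?thesis
    by (cases "n = m") (simp_all add: holomorphic_on_power_int)
qed

text \<open>Fourier orthogonality on a single circle. Each term has constant modulus there and
  summability of complex families is absolute, so one point of the circle supplies the majorant for
  termwise integration.\<close>

lemma laurent_coeffs_zero:
  fixes c :: "int \<Rightarrow> complex"
  assumes "\<rho> > 0"
    and "\<And>w. norm w = \<rho> \<Longrightarrow> ((\<lambda>n. c n * w powi n) has_sum 0) UNIV"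
  shows "c m = 0"
proof -
  define f where "f n w = c n * (w powi n * w powi (-(m+1)))" for n and w :: complex
  let ?F = "finite_subsets_at_top (UNIV :: int set)"
  have f_int: "(f n has_contour_integral (c n * (if n = m then of_real (2 * pi) * \<i> else 0)))
                (circlepath 0 \<rho>)" for n
    unfolding f_def by (intro has_contour_integral_lmul has_contour_integral_powi_circlepath assms)
  have f_sum: "((\<lambda>n. f n w) has_sum 0) UNIV" if "norm w = \<rho>" for w
    using has_sum_cmult_left[OF assms(2)[OF that], of "w powi (-(m+1))"]
    by (simp add: f_def mult.assoc)
  have "uniform_limit (sphere 0 \<rho>) (\<lambda>X w. \<Sum>n\<in>X. f n w) (\<lambda>_. 0) ?F"
  proof (rule Weierstrass_m_test_general')
    have "(\<lambda>n. f n (of_real \<rho>)) summable_on UNIV"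
      using f_sum[of "of_real \<rho>"] assms(1) has_sum_imp_summable by fastforce
    then show "(\<lambda>n. norm (f n (of_real \<rho>))) summable_on UNIV"
      by (simp add: summable_on_iff_abs_summable_on_complex)
  qed (use assms(1) f_sum in \<open>auto simp: f_def norm_mult norm_power_int\<close>)
  moreover have "\<forall>\<^sub>F X in ?F. (\<lambda>w. \<Sum>n\<in>X. f n w) contour_integrable_on circlepath 0 \<rho>"
    using f_int
    by (intro eventually_finite_subsets_at_top_weakI contour_integrable_sum)
       (auto simp: contour_integrable_on_def)
  ultimately have "((\<lambda>X. contour_integral (circlepath 0 \<rho>) (\<lambda>w. \<Sum>n\<in>X. f n w)) \<longlongrightarrow>
               contour_integral (circlepath 0 \<rho>) (\<lambda>_. 0)) ?F"
    using assms(1) by (intro contour_integral_uniform_limit_circlepath) auto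
  moreover have "\<forall>\<^sub>F X in ?F. contour_integral (circlepath 0 \<rho>) (\<lambda>w. \<Sum>n\<in>X. f n w) =
                               c m * (of_real (2 * pi) * \<i>)"
    unfolding eventually_finite_subsets_at_top
  proof (intro exI[of _ "{m}"] conjI allI impI)
    fix X assume X: "finite X \<and> {m} \<subseteq> X \<and> X \<subseteq> (UNIV :: int set)"
    then have "((\<lambda>w. \<Sum>n\<in>X. f n w) has_contour_integral
       (\<Sum>n\<in>X. c n * (if n = m then of_real (2 * pi) * \<i> else 0))) (circlepath 0 \<rho>)"
      by (intro has_contour_integral_sum f_int) auto
    also have "(\<Sum>n\<in>X. c n * (if n = m then of_real (2 * pi) * \<i> else 0)) = c m * (of_real (2 * pi) * \<i>)"
      using X by (simp add: if_distrib[of "\<lambda>x. _ * x"] cong: if_cong)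
    finally show "contour_integral (circlepath 0 \<rho>) (\<lambda>w. \<Sum>n\<in>X. f n w) = c m * (of_real (2 * pi) * \<i>)"
      by (rule contour_integral_unique)
  qed auto
  ultimately have "((\<lambda>X. c m * (of_real (2 * pi) * \<i>)) \<longlongrightarrow> 0) ?F"
    by (simp add: tendsto_cong)
  then show ?thesis
    by (simp add: tendsto_const_iff)
qed

lemma laurent_coeffs_unique:
  fixes c d :: "int \<Rightarrow> complex"
  assumes "\<rho> > 0"
    and "\<And>w. norm w = \<rho> \<Longrightarrow> ((\<lambda>n. c n * w powi n) has_sum F w) UNIV"
    and "\<And>w. norm w = \<rho> \<Longrightarrow> ((\<lambda>n. d n * w powi n) has_sum F w) UNIV"
  shows "c m = d m"
proof -
  have "c m - d m = 0"
  proof (rule laurent_coeffs_zero[OF assms(1)])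
    fix w :: complex assume "norm w = \<rho>"
    from has_sum_add[OF assms(2)[OF this] has_sum_uminusI[OF assms(3)[OF this]]]
    show "((\<lambda>n. (c n - d n) * w powi n) has_sum 0) UNIV"
      by (simp add: left_diff_distrib)
  qed
  then show ?thesis by simp
qed

section \<open>Lower triangular operators on formal power series\<close>

text \<open>Encodes an infinite lower triangular matrix acting on coefficient sequences: by the last
  clause, coefficient m of the output sees only the coefficients 0, ..., m of the input. This form
  composes without matrix sums.\<close>

definition causal :: "('a::comm_ring_1 fps \<Rightarrow> 'a fps) \<Rightarrow> bool" where
  "causal F \<longleftrightarrow> (\<forall>f g. F (f + g) = F f + F g) \<and> (\<forall>c f. F (fps_const c * f) = fps_const c * F f) \<and>
     (\<forall>f m. (\<forall>i\<le>m. fps_nth f i = 0) \<longrightarrow> fps_nth (F f) m = 0)"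

lemma causal_add: "causal F \<Longrightarrow> F (f + g) = F f + F g"
  and causal_cmult: "causal F \<Longrightarrow> F (fps_const c * f) = fps_const c * F f"
  and causal_nth_0: "causal F \<Longrightarrow> (\<And>i. i \<le> m \<Longrightarrow> fps_nth f i = 0) \<Longrightarrow> fps_nth (F f) m = 0"
  by (auto simp: causal_def)

lemma causalI:
  assumes "\<And>f g. F (f + g) = F f + F g" "\<And>c f. F (fps_const c * f) = fps_const c * F f"
    and "\<And>f m. (\<And>i. i \<le> m \<Longrightarrow> fps_nth f i = 0) \<Longrightarrow> fps_nth (F f) m = 0"
  shows "causal F"
  using assms unfolding causal_def by blast

lemma causal_diff:
  assumes "causal F"
  shows "F (f - g) = F f - F g"
  using causal_add[OF assms, of "f - g" g] by (simp add: eq_diff_eq)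

lemma causal_zero:
  assumes "causal F"
  shows "F 0 = 0"
  using causal_diff[OF assms, of 0 0] by simp

lemma causal_sum:
  assumes "causal F"
  shows "F (\<Sum>i\<in>A. f i) = (\<Sum>i\<in>A. F (f i))"
  by (induction A rule: infinite_finite_induct) (simp_all add: causal_zero[OF assms] causal_add[OF assms])

text \<open>Linearity covers finite sums only, but the tail f - p is invisible at index m. This
  recovers the matrix entries without any topology on the series.\<close>

lemma causal_nth:
  assumes "causal F"
  shows "fps_nth (F f) m = (\<Sum>i\<le>m. fps_nth f i * fps_nth (F (fps_X ^ i)) m)"
proof -
  define p where "p = (\<Sum>i\<le>m. fps_const (fps_nth f i) * fps_X ^ i)"
  have "fps_nth (f - p) i = 0" if "i \<le> m" for i
    using that by (simp add: p_def fps_sum_nth if_distrib[of "\<lambda>x. _ * x"] cong: if_cong)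
  then have "fps_nth (F (f - p)) m = 0"
    by (rule causal_nth_0[OF assms])
  then have "fps_nth (F f) m = fps_nth (F p) m"
    by (simp add: causal_diff[OF assms])
  also have "F p = (\<Sum>i\<le>m. fps_const (fps_nth f i) * F (fps_X ^ i))"
    unfolding p_def by (simp add: causal_sum[OF assms] causal_cmult[OF assms])
  finally show ?thesis
    by (simp add: fps_sum_nth)
qed

lemma causal_lower:
  assumes "causal F" "m < j"
  shows "fps_nth (F (fps_X ^ j)) m = 0"
  by (rule causal_nth_0[OF assms(1)]) (use assms(2) in auto)

lemma causal_eqI:
  fixes F G :: "'a::comm_ring_1 fps \<Rightarrow> 'a fps"
  assumes "causal F" "causal G" "\<And>j. F (fps_X ^ j) = G (fps_X ^ j)"
  shows "F f = G f"
  by (rule fps_ext) (simp only: causal_nth[OF assms(1), of f] causal_nth[OF assms(2), of f] assms(3))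

lemma causal_comp:
  fixes F G :: "'a::comm_ring_1 fps \<Rightarrow> 'a fps"
  assumes "causal F" "causal G"
  shows "causal (\<lambda>f. F (G f))"
proof (rule causalI)
  fix f :: "'a fps" and m assume "\<And>i. i \<le> m \<Longrightarrow> fps_nth f i = 0"
  then show "fps_nth (F (G f)) m = 0"
    by (intro causal_nth_0[OF assms(1)] causal_nth_0[OF assms(2)]) auto
qed (simp_all only: causal_add[OF assms(1)] causal_add[OF assms(2)] causal_cmult[OF assms(1)] causal_cmult[OF assms(2)])

lemma causal_minus:
  fixes F G :: "'a::comm_ring_1 fps \<Rightarrow> 'a fps"
  assumes "causal F" "causal G"
  shows "causal (\<lambda>f. F f - G f)"
  by (rule causalI) (simp_all add: assms[THEN causal_add] assms[THEN causal_cmult] assms[THEN causal_nth_0] right_diff_distrib distrib_left add_ac)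

lemma causal_plus:
  fixes F G :: "'a::comm_ring_1 fps \<Rightarrow> 'a fps"
  assumes "causal F" "causal G"
  shows "causal (\<lambda>f. F f + G f)"
  by (rule causalI) (simp_all add: assms[THEN causal_add] assms[THEN causal_cmult] assms[THEN causal_nth_0] right_diff_distrib distrib_left add_ac)

lemma causal_mult:
  fixes F :: "'a::comm_ring_1 fps \<Rightarrow> 'a fps"
  assumes "causal F"
  shows "causal (\<lambda>f. g * F f)"
proof (rule causalI)
  fix f :: "'a fps" and m assume "\<And>i. i \<le> m \<Longrightarrow> fps_nth f i = 0"
  then show "fps_nth (g * F f) m = 0"
    unfolding fps_mult_nth by (intro sum.neutral ballI) (simp add: causal_nth_0[OF assms])
qed (simp_all add: causal_add[OF assms] causal_cmult[OF assms] distrib_left mult.left_commute)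

lemma causal_id: "causal (\<lambda>f. f)"
  by (simp add: causal_def)

lemma causal_Abs_fps:
  fixes c :: "nat \<Rightarrow> nat \<Rightarrow> 'a::comm_ring_1"
  shows "causal (\<lambda>f. Abs_fps (\<lambda>m. \<Sum>j\<le>m. c m j * fps_nth f j))"
proof (rule causalI)
  fix f g :: "'a fps"
  show "Abs_fps (\<lambda>m. \<Sum>j\<le>m. c m j * fps_nth (f + g) j) =
      Abs_fps (\<lambda>m. \<Sum>j\<le>m. c m j * fps_nth f j) + Abs_fps (\<lambda>m. \<Sum>j\<le>m. c m j * fps_nth g j)"
    by (rule fps_ext) (simp add: distrib_left sum.distrib)
next
  fix a and f :: "'a fps"
  show "Abs_fps (\<lambda>m. \<Sum>j\<le>m. c m j * fps_nth (fps_const a * f) j) =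
      fps_const a * Abs_fps (\<lambda>m. \<Sum>j\<le>m. c m j * fps_nth f j)"
    by (rule fps_ext) (simp add: sum_distrib_left mult.left_commute)
qed (simp add: sum.neutral)

lemma causal_diagonal:
  assumes "causal F" "\<And>i. i < m \<Longrightarrow> fps_nth f i = 0"
  shows "fps_nth (F f) m = fps_nth f m * fps_nth (F (fps_X ^ m)) m"
proof -
  have "(\<Sum>i\<le>m. fps_nth f i * fps_nth (F (fps_X ^ i)) m) =
          (\<Sum>i\<in>{m}. fps_nth f i * fps_nth (F (fps_X ^ i)) m)"
  proof (rule sum.mono_neutral_right; (intro ballI)?)
    fix i assume "i \<in> {..m} - {m}"
    then have "i < m" by auto
    then show "fps_nth f i * fps_nth (F (fps_X ^ i)) m = 0"
      by (simp add: assms(2))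
  qed auto
  then show ?thesis
    by (simp only: causal_nth[OF assms(1), of f] sum.insert finite.emptyI) simp
qed

text \<open>The commutator \<open>C\<close> commutes with \<open>L\<close>, and its diagonal
  vanishes because diagonals of triangular matrices multiply. At distance n below the diagonal,
  compare the entries of \<open>C L\<close> and \<open>L C\<close> in column j: every other term has
  either an entry above the diagonal or an entry of \<open>C\<close> nearer to it, which leaves the
  entry of \<open>C\<close> times the difference of two distinct eigenvalues.\<close>

lemma causal_commute:
  fixes F G L :: "'a::idom fps \<Rightarrow> 'a fps"
  assumes "causal F" "causal G" "causal L"
    and FL: "\<And>f. F (L f) = L (F f)" and GL: "\<And>f. G (L f) = L (G f)"
    and inj: "inj (\<lambda>m. fps_nth (L (fps_X ^ m)) m)"
  shows "F (G f) = G (F f)"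
proof -
  define C where "C f = F (G f) - G (F f)" for f
  have C: "causal C"
    unfolding C_def by (rule causal_minus[OF causal_comp[OF assms(1,2)] causal_comp[OF assms(2,1)]])
  have CL: "C (L f) = L (C f)" for f
    by (simp add: C_def FL GL causal_diff[OF assms(3)])
  have "fps_nth (C (fps_X ^ j)) (j + n) = 0" for j n
  proof (induction n arbitrary: j rule: less_induct)
    case (less n)
    show ?case
    proof (cases "n = 0")
      case True
      have "fps_nth (F (G (fps_X ^ j))) j = fps_nth (G (F (fps_X ^ j))) j"
        using causal_diagonal[OF assms(1), of j "G (fps_X ^ j)"] causal_lower[OF assms(1), of _ j]
          causal_diagonal[OF assms(2), of j "F (fps_X ^ j)"] causal_lower[OF assms(2), of _ j]
        by (simp add: mult.commute)
      with True show ?thesis by (simp add: C_def)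
    next
      case False
      let ?m = "j + n"
      have "fps_nth (C (L (fps_X ^ j))) ?m =
              (\<Sum>i\<le>?m. fps_nth (L (fps_X ^ j)) i * fps_nth (C (fps_X ^ i)) ?m)"
        by (rule causal_nth[OF C])
      also have "\<dots> = (\<Sum>i\<in>{j}. fps_nth (L (fps_X ^ j)) i * fps_nth (C (fps_X ^ i)) ?m)"
      proof (intro sum.mono_neutral_right ballI)
        fix i assume i: "i \<in> {..?m} - {j}"
        show "fps_nth (L (fps_X ^ j)) i * fps_nth (C (fps_X ^ i)) ?m = 0"
        proof (cases "i < j")
          case False
          then have "?m - i < n" "i + (?m - i) = ?m"
            using i by auto
          then show ?thesis
            using less.IH[of "?m - i" i] by simp
        qed (simp add: causal_lower[OF assms(3)])
      qed auto
      finally have 1: "fps_nth (C (L (fps_X ^ j))) ?m =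
          fps_nth (L (fps_X ^ j)) j * fps_nth (C (fps_X ^ j)) ?m" by simp
      have "fps_nth (L (C (fps_X ^ j))) ?m =
              (\<Sum>i\<le>?m. fps_nth (C (fps_X ^ j)) i * fps_nth (L (fps_X ^ i)) ?m)"
        by (rule causal_nth[OF assms(3)])
      also have "\<dots> = (\<Sum>i\<in>{?m}. fps_nth (C (fps_X ^ j)) i * fps_nth (L (fps_X ^ i)) ?m)"
      proof (intro sum.mono_neutral_right ballI)
        fix i assume i: "i \<in> {..?m} - {?m}"
        show "fps_nth (C (fps_X ^ j)) i * fps_nth (L (fps_X ^ i)) ?m = 0"
        proof (cases "i < j")
          case False
          then have "i - j < n" "j + (i - j) = i"
            using i by auto
          then show ?thesis
            using less.IH[of "i - j" j] by simp
        qed (simp add: causal_lower[OF C])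
      qed auto
      finally have "fps_nth (C (fps_X ^ j)) ?m *
          (fps_nth (L (fps_X ^ j)) j - fps_nth (L (fps_X ^ ?m)) ?m) = 0"
        using 1 unfolding CL by (simp only: right_diff_distrib mult.commute)  simp
      moreover have "fps_nth (L (fps_X ^ j)) j \<noteq> fps_nth (L (fps_X ^ ?m)) ?m"
        using inj False by (auto dest: injD)
      ultimately show ?thesis by simp
    qed
  qed
  then have "fps_nth (C (fps_X ^ j)) m = 0" for j m
    using causal_lower[OF C, of m j] le_add_diff_inverse[of j m] by (metis not_less)
  then have "fps_nth (C f) m = 0" for m
    unfolding causal_nth[OF C, of f] by (intro sum.neutral) simp
  then have "C f = 0"
    by (intro fps_ext) simp
  then show ?thesis by (simp add: C_def)
qed

definition fps_scale :: "'a::comm_ring_1 \<Rightarrow> 'a fps \<Rightarrow> 'a fps" where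
  "fps_scale c f = f oo (fps_const c * fps_X)"

lemma fps_scale_nth [simp]: "fps_nth (fps_scale c f) n = c ^ n * fps_nth f n"
  by (simp add: fps_scale_def fps_compose_linear)

lemma fps_scale_mult:
  fixes f g :: "'a::idom fps"
  shows "fps_scale c (f * g) = fps_scale c f * fps_scale c g"
  unfolding fps_scale_def by (rule fps_compose_mult_distrib) simp

lemma fps_scale_inverse [simp]:
  fixes c :: "'a::field"
  assumes "c \<noteq> 0"
  shows "fps_scale (1 / c) (fps_scale c f) = f"
  by (rule fps_ext) (simp add: assms power_divide)

lemma fps_scale_linear [simp]: "fps_scale c (1 - fps_const a * fps_X) = 1 - fps_const (a * c) * fps_X"
  by (rule fps_ext) (auto simp: fps_X_def)

lemma causal_scale: "causal (fps_scale c)"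
  by (rule causalI; (rule fps_ext)?) (simp_all add: distrib_left mult.left_commute)

section \<open>The \<open>q\<close>-difference operator\<close>

text \<open>In the notation of \<open>q\<close>-series this is \<open>(tA;q)\<^sub>n / (qA;q)\<^sub>n\<close>.\<close>

definition qratio :: "complex \<Rightarrow> complex \<Rightarrow> complex \<Rightarrow> nat \<Rightarrow> complex" where
  "qratio q t A n = (\<Prod>i<n. (1 - t * A * q ^ i) / (1 - A * q ^ Suc i))"

lemma qratio_Suc: "qratio q t A (Suc n) = qratio q t A n * ((1 - t * A * q ^ n) / (1 - A * q ^ Suc n))"
  by (simp add: qratio_def)

text \<open>The matrix entry N places below the diagonal in column j, without its power of q/t. The
  weights \<open>G\<close> come from g(\<xi>2/\<zeta>1) and g(\<zeta>2/\<xi>1); \<open>r\<close> and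
  \<open>r'\<close> come from the kernel coefficients of nonpositive and of nonnegative
  index.\<close>

definition conv_sum :: "(nat \<Rightarrow> complex) \<Rightarrow> (nat \<Rightarrow> complex) \<Rightarrow> (nat \<Rightarrow> complex) \<Rightarrow> nat \<Rightarrow> nat \<Rightarrow> complex" where
  "conv_sum G r r' N j = (\<Sum>a\<le>N. G a * G (N - a) * r (j + (N - a)) * r' (j + a))"

text \<open>Split 1 - q^(N+1) as (1 - q^a) + q^a (1 - q^(N+1-a)). The recurrence of \<open>G\<close>
  absorbs each part by lowering one of the two indices, and the boundary terms vanish through the
  factor 1 - q^0.\<close>

lemma conv_sum_raise:
  fixes q t :: complex
  assumes "\<And>k. G (Suc k) * (1 - q ^ Suc k) = G k * (1 - t * q ^ k)"
  shows "(1 - q ^ Suc N) * conv_sum G r r' (Suc N) j =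
    (\<Sum>a\<le>N. G a * G (N - a) * ((1 - t * q ^ a) * r (j + (N - a)) * r' (Suc (j + a)) +
       q ^ a * (1 - t * q ^ (N - a)) * r (Suc (j + (N - a))) * r' (j + a)))"
proof -
  define f where "f a = G a * G (Suc N - a) * r (j + (Suc N - a)) * r' (j + a)" for a
  have "(1 - q ^ Suc N) * conv_sum G r r' (Suc N) j = (\<Sum>a\<le>Suc N. (1 - q ^ Suc N) * f a)"
    by (simp only: conv_sum_def f_def sum_distrib_left)
  also have "\<dots> = (\<Sum>a\<le>Suc N. (1 - q ^ a) * f a + q ^ a * (1 - q ^ (Suc N - a)) * f a)"
  proof (rule sum.cong[OF refl])
    fix a assume "a \<in> {..Suc N}"
    then have "q ^ Suc N = q ^ a * q ^ (Suc N - a)"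
      by (simp flip: power_add)
    then show "(1 - q ^ Suc N) * f a = (1 - q ^ a) * f a + q ^ a * (1 - q ^ (Suc N - a)) * f a"
      by (simp only:) (simp add: algebra_simps)
  qed
  also have "\<dots> = (\<Sum>a\<le>Suc N. (1 - q ^ a) * f a) + (\<Sum>a\<le>Suc N. q ^ a * (1 - q ^ (Suc N - a)) * f a)"
    by (rule sum.distrib)
  also have "(\<Sum>a\<le>Suc N. (1 - q ^ a) * f a) = (\<Sum>a\<le>N. (1 - q ^ Suc a) * f (Suc a))"
    by (subst sum.atMost_Suc_shift) simp
  also have "\<dots> = (\<Sum>a\<le>N. G a * G (N - a) * ((1 - t * q ^ a) * r (j + (N - a)) * r' (Suc (j + a))))"
  proof (rule sum.cong[OF refl])
    fix a
    have "(1 - q ^ Suc a) * f (Suc a) =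
        (G (Suc a) * (1 - q ^ Suc a)) * G (N - a) * r (j + (N - a)) * r' (Suc (j + a))"
      by (simp add: f_def mult_ac)
    then show "(1 - q ^ Suc a) * f (Suc a) =
        G a * G (N - a) * ((1 - t * q ^ a) * r (j + (N - a)) * r' (Suc (j + a)))"
      unfolding assms by (simp add: mult_ac)
  qed
  also have "(\<Sum>a\<le>Suc N. q ^ a * (1 - q ^ (Suc N - a)) * f a) =
             (\<Sum>a\<le>N. q ^ a * (1 - q ^ (Suc N - a)) * f a)"
    by simp
  also have "\<dots> = (\<Sum>a\<le>N. G a * G (N - a) *
                   (q ^ a * (1 - t * q ^ (N - a)) * r (Suc (j + (N - a))) * r' (j + a)))"
  proof (rule sum.cong[OF refl])
    fix a assume "a \<in> {..N}"
    then have "Suc N - a = Suc (N - a)" by simp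
    then have "q ^ a * (1 - q ^ (Suc N - a)) * f a =
        q ^ a * G a * (G (Suc (N - a)) * (1 - q ^ Suc (N - a))) * r (Suc (j + (N - a))) * r' (j + a)"
      by (simp add: f_def mult_ac)
    then show "q ^ a * (1 - q ^ (Suc N - a)) * f a = G a * G (N - a) *
        (q ^ a * (1 - t * q ^ (N - a)) * r (Suc (j + (N - a))) * r' (j + a))"
      unfolding assms by (simp add: mult_ac)
  qed
  finally show ?thesis
    by (simp only: sum.distrib distrib_left)
qed

text \<open>The mirror image of \<open>conv_sum_raise\<close>: split 1 - t^2 q^N as (1 - t q^a) + t
  q^a (1 - t q^(N-a)) and use the recurrence of \<open>G\<close> to raise one index in each
  part.\<close>

lemma conv_sum_lower:
  fixes q t :: complex
  assumes "\<And>k. G (Suc k) * (1 - q ^ Suc k) = G k * (1 - t * q ^ k)"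
  shows "(1 - t\<^sup>2 * q ^ N) * conv_sum G r r' N (Suc j) =
    (\<Sum>a\<le>Suc N. G a * G (Suc N - a) * ((1 - q ^ a) * r (Suc (j + (Suc N - a))) * r' (j + a) +
       t * q ^ a * (1 - q ^ (Suc N - a)) * r (j + (Suc N - a)) * r' (Suc (j + a))))"
proof -
  define f where "f a = r (Suc (j + (N - a))) * r' (Suc (j + a))" for a
  have 1: "(\<Sum>a\<le>Suc N. G a * G (Suc N - a) * ((1 - q ^ a) * r (Suc (j + (Suc N - a))) * r' (j + a))) =
        (\<Sum>a\<le>N. G a * G (N - a) * (1 - t * q ^ a) * f a)"
  proof -
    have "G (Suc a) * G (N - a) * ((1 - q ^ Suc a) * r (Suc (j + (N - a))) * r' (Suc (j + a))) =
      G a * G (N - a) * (1 - t * q ^ a) * f a" for a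
    proof -
      have "G (Suc a) * G (N - a) * ((1 - q ^ Suc a) * r (Suc (j + (N - a))) * r' (Suc (j + a))) =
        (G (Suc a) * (1 - q ^ Suc a)) * G (N - a) * f a"
        by (simp add: f_def mult_ac)
      then show ?thesis
        unfolding assms by (simp add: mult_ac)
    qed
    then show ?thesis
      by (subst sum.atMost_Suc_shift) (simp only: diff_Suc_Suc power_0 diff_self mult_zero_left
          mult_zero_right add_0 add_Suc_right)
  qed
  have "(\<Sum>a\<le>Suc N. G a * G (Suc N - a) * (t * q ^ a * (1 - q ^ (Suc N - a)) * r (j + (Suc N - a)) * r' (Suc (j + a)))) =
        (\<Sum>a\<le>N. G a * G (Suc N - a) * (t * q ^ a * (1 - q ^ (Suc N - a)) * r (j + (Suc N - a)) * r' (Suc (j + a))))"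
    by simp
  also have "\<dots> = (\<Sum>a\<le>N. G a * G (N - a) * (t * q ^ a * (1 - t * q ^ (N - a))) * f a)"
  proof (rule sum.cong[OF refl])
    fix a assume "a \<in> {..N}"
    then have *: "Suc N - a = Suc (N - a)" by simp
    have "G a * G (Suc N - a) * (t * q ^ a * (1 - q ^ (Suc N - a)) * r (j + (Suc N - a)) * r' (Suc (j + a))) =
       G a * (G (Suc (N - a)) * (1 - q ^ Suc (N - a))) * (t * q ^ a) * f a"
      unfolding * by (simp add: f_def mult_ac)
    then show "G a * G (Suc N - a) * (t * q ^ a * (1 - q ^ (Suc N - a)) * r (j + (Suc N - a)) * r' (Suc (j + a))) =
        G a * G (N - a) * (t * q ^ a * (1 - t * q ^ (N - a))) * f a"
      unfolding assms by (simp add: mult_ac)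
  qed
  finally have "(\<Sum>a\<le>Suc N. G a * G (Suc N - a) * ((1 - q ^ a) * r (Suc (j + (Suc N - a))) * r' (j + a) +
       t * q ^ a * (1 - q ^ (Suc N - a)) * r (j + (Suc N - a)) * r' (Suc (j + a)))) =
     (\<Sum>a\<le>N. G a * G (N - a) * (1 - t * q ^ a) * f a + G a * G (N - a) * (t * q ^ a * (1 - t * q ^ (N - a))) * f a)"
    unfolding distrib_left sum.distrib 1 by simp
  also have "\<dots> = (\<Sum>a\<le>N. (1 - t\<^sup>2 * q ^ N) * (G a * G (N - a) * f a))"
  proof (rule sum.cong[OF refl])
    fix a assume "a \<in> {..N}"
    then have *: "q ^ N = q ^ a * q ^ (N - a)"
      by (simp flip: power_add)
    show "G a * G (N - a) * (1 - t * q ^ a) * f a + G a * G (N - a) * (t * q ^ a * (1 - t * q ^ (N - a))) * f a =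
      (1 - t\<^sup>2 * q ^ N) * (G a * G (N - a) * f a)"
      unfolding * by (simp add: algebra_simps power2_eq_square)
  qed
  finally show ?thesis
    by (simp add: conv_sum_def f_def sum_distrib_left mult_ac)
qed

text \<open>Divided by r P * r' S and cleared of denominators, this is a polynomial identity in a =
  t x, b = t y, c = q x, d = q y. Since a d = b c =: p, both sides equal 2 - e + p e - 2 p^2 with e
  = a + b + c + d.\<close>

lemma qratio_four_term:
  fixes q t A A' :: complex
  defines "r \<equiv> qratio q t A" and "r' \<equiv> qratio q t A'"
  assumes A: "\<And>i. A * q ^ Suc i \<noteq> 1" and A': "\<And>i. A' * q ^ Suc i \<noteq> 1"
  shows "(1 - t * A * A' * q ^ Suc (P + S)) * (r P * r' (Suc S) + r (Suc P) * r' S) =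
         (1 - A * A' * q ^ Suc (Suc (P + S))) * (r (Suc P) * r' (Suc S)) +
         (1 - t\<^sup>2 * A * A' * q ^ (P + S)) * (r P * r' S)"
proof -
  define x where "x = A * q ^ P"
  define y where "y = A' * q ^ S"
  define \<rho> where "\<rho> = (1 - t * x) / (1 - x * q)"
  define \<sigma> where "\<sigma> = (1 - t * y) / (1 - y * q)"
  have nz: "1 - x * q \<noteq> 0" "1 - y * q \<noteq> 0"
    using A[of P] A'[of S] by (auto simp: x_def y_def mult_ac)
  have r: "r (Suc P) = r P * \<rho>" "r' (Suc S) = r' S * \<sigma>"
    unfolding r_def r'_def qratio_Suc \<rho>_def \<sigma>_def x_def y_def by (simp_all add: mult_ac)
  have "(1 - t * x * y * q) * (\<sigma> + \<rho>) = (1 - x * y * q\<^sup>2) * (\<rho> * \<sigma>) + (1 - t\<^sup>2 * x * y)"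
    unfolding \<rho>_def \<sigma>_def using nz by (simp add: divide_simps) algebra
  then have "(r P * r' S) * ((1 - t * x * y * q) * (\<sigma> + \<rho>)) =
      (r P * r' S) * ((1 - x * y * q\<^sup>2) * (\<rho> * \<sigma>) + (1 - t\<^sup>2 * x * y))"
    by simp
  then show ?thesis
    unfolding r by (simp add: x_def y_def power_add power2_eq_square algebra_simps)
qed

text \<open>After both weighted sums are pushed to the weights \<open>G\<^sub>a G\<^sub>b\<close> with \<open>a + b = N\<close>, a common factor
  \<open>1 - t q\<^sup>N\<close> splits off and the identity holds term by term by \<open>qratio_four_term\<close>. The
  conditional stands for \<open>\<kappa>\<close> at the index \<open>N - 1\<close>, which would be truncated at \<open>N = 0\<close>.\<close>

lemma conv_sum_four_term:
  fixes q t A A' :: complex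
  assumes G: "\<And>k. G (Suc k) * (1 - q ^ Suc k) = G k * (1 - t * q ^ k)"
    and A: "\<And>i. A * q ^ Suc i \<noteq> 1" and A': "\<And>i. A' * q ^ Suc i \<noteq> 1" and q: "q \<noteq> 0"
  defines "\<kappa> \<equiv> conv_sum G (qratio q t A) (qratio q t A')"
  shows "(1 - q ^ Suc N) * (1 - t * A * A' * q ^ Suc (2 * j + N)) * \<kappa> (Suc N) j +
         (1 - t\<^sup>2 * q ^ N / q) * (1 - t * A * A' * q ^ Suc (2 * j + N)) *
           (if N = 0 then 0 else \<kappa> (N - 1) (Suc j)) =
         (1 - t * q ^ N) * ((1 - A * A' * q ^ Suc (Suc (2 * j + N))) * \<kappa> N (Suc j) +
           (1 - t\<^sup>2 * A * A' * q ^ (2 * j + N)) * \<kappa> N j)"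
proof -
  define r where "r = qratio q t A"
  define r' where "r' = qratio q t A'"
  define w where "w a = G a * G (N - a)" for a
  define e where "e a = r (j + (N - a)) * r' (Suc (j + a)) + r (Suc (j + (N - a))) * r' (j + a)" for a
  have 1: "(1 - q ^ Suc N) * \<kappa> (Suc N) j = (\<Sum>a\<le>N. w a * ((1 - t * q ^ a) * r (j + (N - a)) * r' (Suc (j + a)) +
       q ^ a * (1 - t * q ^ (N - a)) * r (Suc (j + (N - a))) * r' (j + a)))"
    unfolding \<kappa>_def r_def r'_def w_def by (rule conv_sum_raise[OF G])
  \<comment> \<open>At N = 0 the only term has a = 0 and carries the factors 1 - q^0, in agreement
    with the default value 0.\<close>
  have 2: "(1 - t\<^sup>2 * q ^ N / q) * (if N = 0 then 0 else \<kappa> (N - 1) (Suc j)) =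
     (\<Sum>a\<le>N. w a * ((1 - q ^ a) * r (Suc (j + (N - a))) * r' (j + a) +
       t * q ^ a * (1 - q ^ (N - a)) * r (j + (N - a)) * r' (Suc (j + a))))"
  proof (cases N)
    case (Suc n)
    then have "t\<^sup>2 * q ^ N / q = t\<^sup>2 * q ^ n" using q by simp
    with Suc conv_sum_lower[OF G, of n r r' j] show ?thesis
      unfolding \<kappa>_def r_def r'_def w_def by simp
  qed simp
  \<comment> \<open>The two expansions combine because (1 - t q^a) + t q^a (1 - q^(N-a)) and q^a (1
    - t q^(N-a)) + (1 - q^a) are both 1 - t q^N.\<close>
  have "(1 - q ^ Suc N) * \<kappa> (Suc N) j + (1 - t\<^sup>2 * q ^ N / q) * (if N = 0 then 0 else \<kappa> (N - 1) (Suc j)) =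
        (\<Sum>a\<le>N. (1 - t * q ^ N) * (w a * e a))"
    unfolding 1 2 sum.distrib[symmetric]
  proof (rule sum.cong[OF refl])
    fix a assume "a \<in> {..N}"
    then have *: "q ^ N = q ^ a * q ^ (N - a)"
      by (simp flip: power_add)
    show "w a * ((1 - t * q ^ a) * r (j + (N - a)) * r' (Suc (j + a)) +
       q ^ a * (1 - t * q ^ (N - a)) * r (Suc (j + (N - a))) * r' (j + a)) +
      w a * ((1 - q ^ a) * r (Suc (j + (N - a))) * r' (j + a) +
       t * q ^ a * (1 - q ^ (N - a)) * r (j + (N - a)) * r' (Suc (j + a))) =
      (1 - t * q ^ N) * (w a * e a)"
      unfolding * e_def by (simp add: algebra_simps)
  qed
  then have 3: "(1 - q ^ Suc N) * \<kappa> (Suc N) j + (1 - t\<^sup>2 * q ^ N / q) * (if N = 0 then 0 else \<kappa> (N - 1) (Suc j)) =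
        (1 - t * q ^ N) * (\<Sum>a\<le>N. w a * e a)"
    by (simp only: sum_distrib_left)
  have "(1 - t * A * A' * q ^ Suc (2 * j + N)) * (\<Sum>a\<le>N. w a * e a) =
        (\<Sum>a\<le>N. w a * ((1 - t * A * A' * q ^ Suc (2 * j + N)) * e a))"
    by (simp only: sum_distrib_left mult.left_commute)
  also have "\<dots> = (\<Sum>a\<le>N. (1 - A * A' * q ^ Suc (Suc (2 * j + N))) * (w a * r (Suc j + (N - a)) * r' (Suc j + a)) +
                       (1 - t\<^sup>2 * A * A' * q ^ (2 * j + N)) * (w a * r (j + (N - a)) * r' (j + a)))"
  proof (rule sum.cong[OF refl])
    fix a assume "a \<in> {..N}"
    then have *: "j + (N - a) + (j + a) = 2 * j + N" by simp
    have "(1 - t * A * A' * q ^ Suc (2 * j + N)) * e a =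
         (1 - A * A' * q ^ Suc (Suc (2 * j + N))) * (r (Suc (j + (N - a))) * r' (Suc (j + a))) +
         (1 - t\<^sup>2 * A * A' * q ^ (2 * j + N)) * (r (j + (N - a)) * r' (j + a))"
      using qratio_four_term[OF A A', of t "j + (N - a)" "j + a"]
      unfolding * e_def r_def r'_def .
    then show "w a * ((1 - t * A * A' * q ^ Suc (2 * j + N)) * e a) =
        (1 - A * A' * q ^ Suc (Suc (2 * j + N))) * (w a * r (Suc j + (N - a)) * r' (Suc j + a)) +
                       (1 - t\<^sup>2 * A * A' * q ^ (2 * j + N)) * (w a * r (j + (N - a)) * r' (j + a))"
      by (simp only: add_Suc) (simp only: distrib_left mult_ac)
  qed
  also have "\<dots> = (1 - A * A' * q ^ Suc (Suc (2 * j + N))) * \<kappa> N (Suc j) +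
           (1 - t\<^sup>2 * A * A' * q ^ (2 * j + N)) * \<kappa> N j"
    unfolding \<kappa>_def conv_sum_def r_def r'_def w_def sum_distrib_left sum.distrib ..
  finally have 4: "(1 - t * A * A' * q ^ Suc (2 * j + N)) * (\<Sum>a\<le>N. w a * e a) = \<dots>" .
  have "(1 - t * A * A' * q ^ Suc (2 * j + N)) * ((1 - q ^ Suc N) * \<kappa> (Suc N) j +
          (1 - t\<^sup>2 * q ^ N / q) * (if N = 0 then 0 else \<kappa> (N - 1) (Suc j))) =
        (1 - t * q ^ N) * ((1 - A * A' * q ^ Suc (Suc (2 * j + N))) * \<kappa> N (Suc j) +
           (1 - t\<^sup>2 * A * A' * q ^ (2 * j + N)) * \<kappa> N j)"
    unfolding 3 4[symmetric] by (simp only: mult.left_commute)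
  then show ?thesis
    by (simp only: distrib_left mult_ac)
qed

text \<open>Up to a scalar, \<open>I(\<alpha>)\<close> is \<open>K_op\<close> with \<open>A = s\<^sub>1/\<alpha>\<close> and \<open>A' = \<alpha>/(s\<^sub>2t)\<close>, followed by multiplication
  by \<open>h\<close>. Note that \<open>t A A' = s\<^sub>1/s\<^sub>2\<close> does not depend on \<open>\<alpha>\<close>.\<close>

definition K_op :: "complex \<Rightarrow> complex \<Rightarrow> (nat \<Rightarrow> complex) \<Rightarrow> complex \<Rightarrow> complex \<Rightarrow> complex fps \<Rightarrow> complex fps" where
  "K_op q t G A A' f = Abs_fps (\<lambda>m. \<Sum>j\<le>m.
     (q / t) ^ m * conv_sum G (qratio q t A) (qratio q t A') (m - j) j * fps_nth f j)"

text \<open>\<open>(1 - z)\<^sup>-\<^sup>1 D_op\<close> is the Macdonald operator in two variables; replacing \<open>t\<close> by \<open>q/t\<close> gives its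
  conjugate by the gauge factor \<open>h\<close>, up to a factor \<open>1 - z\<close> on the right instead of the left.\<close>

definition D_op :: "complex \<Rightarrow> complex \<Rightarrow> complex \<Rightarrow> complex fps \<Rightarrow> complex fps" where
  "D_op q t u f = (1 - fps_const (1 / t) * fps_X) * fps_scale (1 / q) f +
                  fps_const u * ((1 - fps_const t * fps_X) * fps_scale q f)"

lemma causal_K: "causal (K_op q t G A A')"
  unfolding K_op_def by (rule causal_Abs_fps)

section \<open>Matrix entries of the two operators and their intertwining relation\<close>

lemma causal_D: "causal (D_op q t u)"
  unfolding D_op_def by (rule causal_plus[OF causal_mult causal_mult[OF causal_mult]]; rule causal_scale)

lemma K_op_X_power_nth:
  "fps_nth (K_op q t G A A' (fps_X ^ j)) m =
     (if j \<le> m then (q / t) ^ m * conv_sum G (qratio q t A) (qratio q t A') (m - j) j else 0)"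
  by (simp add: K_op_def if_distrib[of "\<lambda>x. _ * x"] cong: if_cong)

lemma linear_factor_nth:
  fixes f :: "complex fps"
  shows "fps_nth ((1 - fps_const c * fps_X) * f) 0 = fps_nth f 0"
    and "fps_nth ((1 - fps_const c * fps_X) * f) (Suc m) = fps_nth f (Suc m) - c * fps_nth f m"
  by (simp_all add: left_diff_distrib mult.assoc)

lemma D_op_nth_0: "fps_nth (D_op q t u f) 0 = (1 + u) * fps_nth f 0"
  by (simp add: D_op_def linear_factor_nth distrib_right)

text \<open>The operator is lower bidiagonal, given here by rows and in \<open>D_op_X_power\<close>
  by columns. Composing with it on either side therefore mixes neighbouring entries only.\<close>

lemma D_op_nth_Suc:
  "fps_nth (D_op q t u f) (Suc m) = ((1 / q) ^ Suc m + u * q ^ Suc m) * fps_nth f (Suc m) -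
     (1 / t * (1 / q) ^ m + u * (t * q ^ m)) * fps_nth f m"
  unfolding D_op_def fps_add_nth fps_mult_left_const_nth linear_factor_nth fps_scale_nth
  by (simp only: algebra_simps)

lemma D_op_X_power:
  "D_op q t u (fps_X ^ j) = fps_const ((1 / q) ^ j + u * q ^ j) * fps_X ^ j -
     fps_const (1 / t * (1 / q) ^ j + u * (t * q ^ j)) * fps_X ^ Suc j"
proof (rule fps_ext)
  fix m
  show "fps_nth (D_op q t u (fps_X ^ j)) m = fps_nth (fps_const ((1 / q) ^ j + u * q ^ j) * fps_X ^ j -
     fps_const (1 / t * (1 / q) ^ j + u * (t * q ^ j)) * fps_X ^ Suc j) m"
    unfolding fps_sub_nth fps_mult_left_const_nth fps_X_power_nth
    by (cases m) (auto simp: D_op_nth_0 D_op_nth_Suc)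
qed

text \<open>On a monomial both sides involve the same four entries of \<open>K\<close>, in two
  adjacent rows and two adjacent columns. The relation between them is
  \<open>conv_sum_four_term\<close>.\<close>

lemma K_D_intertwine:
  assumes G: "\<And>k. G (Suc k) * (1 - q ^ Suc k) = G k * (1 - t * q ^ k)"
    and A: "\<And>i. A * q ^ Suc i \<noteq> 1" and A': "\<And>i. A' * q ^ Suc i \<noteq> 1"
    and q: "q \<noteq> 0" and t: "t \<noteq> 0"
  defines "K \<equiv> K_op q t G A A'" and "u \<equiv> t * A * A'"
  shows "(1 - fps_X) * K (D_op q (q / t) u f) = D_op q t u (K ((1 - fps_X) * f))"
proof (rule causal_eqI[where F = "\<lambda>f. (1 - fps_X) * K (D_op q (q / t) u f)"])
  have K: "causal K" unfolding K_def by (rule causal_K)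
  show "causal (\<lambda>f. (1 - fps_X) * K (D_op q (q / t) u f))"
    by (rule causal_mult[OF causal_comp[OF K causal_D]])
  show "causal (\<lambda>f. D_op q t u (K ((1 - fps_X) * f)))"
    by (rule causal_comp[OF causal_D causal_comp[OF K causal_mult[OF causal_id]]])
  fix j
  define k where "k m j = fps_nth (K (fps_X ^ j)) m" for m j
  define d where "d = (1 / q) ^ j + u * q ^ j"
  define e where "e = t / q * (1 / q) ^ j + u * (q / t * q ^ j)"
  have "K (D_op q (q / t) u (fps_X ^ j)) = fps_const d * K (fps_X ^ j) - fps_const e * K (fps_X ^ Suc j)"
    unfolding D_op_X_power causal_diff[OF K] causal_cmult[OF K] d_def e_def by simp
  then have L: "fps_nth (K (D_op q (q / t) u (fps_X ^ j))) m = d * k m j - e * k m (Suc j)" for m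
    by (simp only: fps_sub_nth fps_mult_left_const_nth k_def)
  have "(1 - fps_X) * fps_X ^ j = fps_X ^ j - (fps_X ^ Suc j :: complex fps)"
    by (simp add: left_diff_distrib)
  then have R: "fps_nth (K ((1 - fps_X) * fps_X ^ j)) m = k m j - k m (Suc j)" for m
    by (simp only: causal_diff[OF K] fps_sub_nth k_def)
  have k0: "k m i = 0" if "m < i" for m i
    unfolding k_def using K that by (rule causal_lower)
  have lin: "1 - fps_X = 1 - fps_const 1 * (fps_X :: complex fps)" by simp
  show "(1 - fps_X) * K (D_op q (q / t) u (fps_X ^ j)) = D_op q t u (K ((1 - fps_X) * fps_X ^ j))"
  proof (rule fps_ext)
    fix m
    show "fps_nth ((1 - fps_X) * K (D_op q (q / t) u (fps_X ^ j))) m =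
          fps_nth (D_op q t u (K ((1 - fps_X) * fps_X ^ j))) m"
    proof (cases m)
      case 0
      have "d * k 0 j - e * k 0 (Suc j) = (1 + u) * (k 0 j - k 0 (Suc j))"
        by (cases "j = 0") (simp_all add: k0 d_def)
      then show ?thesis
        unfolding 0 D_op_nth_0 R by (subst lin) (simp only: linear_factor_nth L)
    next
      case (Suc M)
      define c where "c = (1 / q) ^ Suc M + u * q ^ Suc M"
      define c' where "c' = 1 / t * (1 / q) ^ M + u * (t * q ^ M)"
      have "(c - d) * k (Suc M) j - (c - e) * k (Suc M) (Suc j) - (c' - d) * k M j +
            (c' - e) * k M (Suc j) = 0"
      proof -
        \<comment> \<open>For j = M + 1 only the diagonal entry survives, and its coefficient c - d
          is 0; below the diagonal the four-term relation is needed.\<close>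
        consider "Suc M < j" | "j = Suc M" | N where "M = j + N"
          by (metis le_Suc_ex le_SucE not_less)
        then show ?thesis
        proof cases
          case 3
          define Q where "Q = q ^ j"
          define R where "R = q ^ N"
          define s where "s = (q / t) ^ M"
          define \<kappa> where "\<kappa> = conv_sum G (qratio q t A) (qratio q t A')"
          \<comment> \<open>For N = 0 this entry has row j and column j + 1, above the diagonal, so
            the default 0 is its true value.\<close>
          define \<kappa>4 where "\<kappa>4 = (if N = 0 then 0 else \<kappa> (N - 1) (Suc j))"
          have nz: "Q \<noteq> 0" "R \<noteq> 0" using q by (simp_all add: Q_def R_def)
          have ks: "k (Suc M) j = q / t * s * \<kappa> (Suc N) j" "k (Suc M) (Suc j) = q / t * s * \<kappa> N (Suc j)"
            "k M j = s * \<kappa> N j" "k M (Suc j) = s * \<kappa>4"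
            unfolding k_def K_def K_op_X_power_nth \<kappa>_def[symmetric] s_def 3 \<kappa>4_def
            by (auto simp: Suc_diff_le)
          have pw: "q ^ M = Q * R" "(1 / q) ^ M = 1 / (Q * R)" "(1 / q) ^ j = 1 / Q" "q ^ j = Q"
            by (simp_all add: 3 Q_def R_def power_add power_divide)
          \<comment> \<open>All four constants are values of x \<mapsto> 1/x + u x: c at q^(M+1), d
            at q^j, c' at t q^M, e at q^(j+1)/t. Differences of such values factor as (1/x - 1/y)(1
            - u x y).\<close>
          have cd: "(c - d) * (q / t) = (1 - q * R) * (1 - u * (q * Q\<^sup>2 * R)) / (t * Q * R)"
            "(c - e) * (q / t) = (1 - t * R) * (1 - u / t * (q\<^sup>2 * Q\<^sup>2 * R)) / (t * Q * R)"
            "c' - d = (1 - t * R) * (1 - t * u * (Q\<^sup>2 * R)) / (t * Q * R)"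
            "c' - e = (1 - t\<^sup>2 * R / q) * (1 - u * (q * Q\<^sup>2 * R)) / (t * Q * R)"
            unfolding c_def c'_def d_def e_def power_Suc pw
            using q t nz by (simp_all add: field_simps power2_eq_square)
          have pw': "q ^ Suc N = q * R" "q ^ N = R" "q ^ (2 * j + N) = Q\<^sup>2 * R"
            "q ^ Suc (2 * j + N) = q * Q\<^sup>2 * R" "q ^ Suc (Suc (2 * j + N)) = q\<^sup>2 * Q\<^sup>2 * R"
            by (simp_all add: Q_def R_def power_add power2_eq_square mult_2)
          have "(1 - q * R) * (1 - u * (q * Q\<^sup>2 * R)) * \<kappa> (Suc N) j +
              (1 - t\<^sup>2 * R / q) * (1 - u * (q * Q\<^sup>2 * R)) * \<kappa>4 =
              (1 - t * R) * ((1 - u / t * (q\<^sup>2 * Q\<^sup>2 * R)) * \<kappa> N (Suc j) + (1 - t * u * (Q\<^sup>2 * R)) * \<kappa> N j)"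
            using conv_sum_four_term[OF G A A' q, of N j] t
            unfolding \<kappa>_def[symmetric] \<kappa>4_def[symmetric] pw' u_def
            by (simp add: power2_eq_square mult.assoc)
          then have *: "(1 - q * R) * (1 - u * (q * Q\<^sup>2 * R)) * \<kappa> (Suc N) j +
              (1 - t\<^sup>2 * R / q) * (1 - u * (q * Q\<^sup>2 * R)) * \<kappa>4 -
              (1 - t * R) * (1 - u / t * (q\<^sup>2 * Q\<^sup>2 * R)) * \<kappa> N (Suc j) -
              (1 - t * R) * (1 - t * u * (Q\<^sup>2 * R)) * \<kappa> N j = 0"
            by (simp only: distrib_left mult.assoc) simp
          have factor_out: "s * (a1 / z * x1 - a2 / z * x2 - a3 / z * x3 + a4 / z * x4) =
              s / z * (a1 * x1 + a4 * x4 - a2 * x2 - a3 * x3)" for z a1 a2 a3 a4 x1 x2 x3 x4 :: complex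
            by (simp add: diff_divide_distrib add_divide_distrib algebra_simps)
          have "(c - d) * k (Suc M) j - (c - e) * k (Suc M) (Suc j) - (c' - d) * k M j + (c' - e) * k M (Suc j) =
             s * (((c - d) * (q / t)) * \<kappa> (Suc N) j - ((c - e) * (q / t)) * \<kappa> N (Suc j) -
               (c' - d) * \<kappa> N j + (c' - e) * \<kappa>4)"
            unfolding ks by (simp only: right_diff_distrib distrib_left mult_ac)
          also have "\<dots> = s / (t * Q * R) * ((1 - q * R) * (1 - u * (q * Q\<^sup>2 * R)) * \<kappa> (Suc N) j +
              (1 - t\<^sup>2 * R / q) * (1 - u * (q * Q\<^sup>2 * R)) * \<kappa>4 -
              (1 - t * R) * (1 - u / t * (q\<^sup>2 * Q\<^sup>2 * R)) * \<kappa> N (Suc j) -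
              (1 - t * R) * (1 - t * u * (Q\<^sup>2 * R)) * \<kappa> N j)"
            unfolding cd by (rule factor_out)
          finally show ?thesis unfolding * by simp
        qed (simp_all add: k0 c_def d_def)
      qed
      then have "d * k (Suc M) j - e * k (Suc M) (Suc j) - 1 * (d * k M j - e * k M (Suc j)) =
            c * (k (Suc M) j - k (Suc M) (Suc j)) - c' * (k M j - k M (Suc j))"
        by (simp add: algebra_simps)
      then show ?thesis
        unfolding Suc D_op_nth_Suc R c_def[symmetric] c'_def[symmetric]
        by (subst lin) (simp only: linear_factor_nth L)
    qed
  qed
qed

text \<open>The hypothesis handles the summand with q; its dilation by 1/q handles the summand with
  1/q.\<close>

lemma D_op_mult:
  assumes v: "(1 - fps_const (q / t) * fps_X) * fps_scale q v = (1 - fps_const t * fps_X) * v"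
    and q: "q \<noteq> 0"
  shows "D_op q (q / t) u (v * f) = v * D_op q t u f"
proof -
  have "(1 - fps_const (1 / t) * fps_X) * v = (1 - fps_const (t / q) * fps_X) * fps_scale (1 / q) v"
    using arg_cong[OF v, of "fps_scale (1 / q)"] q by (simp add: fps_scale_mult)
  then have v': "(1 - fps_const (1 / (q / t)) * fps_X) * fps_scale (1 / q) v = (1 - fps_const (1 / t) * fps_X) * v"
    by simp
  have "D_op q (q / t) u (v * f) =
     ((1 - fps_const (1 / (q / t)) * fps_X) * fps_scale (1 / q) v) * fps_scale (1 / q) f +
     fps_const u * (((1 - fps_const (q / t) * fps_X) * fps_scale q v) * fps_scale q f)"
    by (simp only: D_op_def fps_scale_mult mult.assoc)
  then show ?thesis
    unfolding v v' D_op_def by (simp only: distrib_left mult_ac)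
qed

text \<open>With x = q^m and y = q^(n-m) the difference is (1 - y)(1 - u x^2 y)/(x y); the exponent
  in x^2 y is m + n \<ge> 1.\<close>

lemma eigenvalues_distinct:
  fixes q u :: complex
  assumes "norm q < 1" "q \<noteq> 0" "\<And>k. u * q ^ Suc k \<noteq> 1"
  shows "inj (\<lambda>m. (1 / q) ^ m + u * q ^ m)"
proof (rule linorder_injI)
  fix m n :: nat assume "m < n"
  then obtain d where n: "n = m + Suc d"
    using less_iff_Suc_add by auto
  show "(1 / q) ^ m + u * q ^ m \<noteq> (1 / q) ^ n + u * q ^ n"
  proof
    assume "(1 / q) ^ m + u * q ^ m = (1 / q) ^ n + u * q ^ n"
    moreover define x where "x = q ^ m"
    moreover define y where "y = q ^ Suc d"
    moreover have "x \<noteq> 0" "y \<noteq> 0"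
      using assms(2) by (simp_all add: x_def y_def)
    ultimately have "1 / x + u * x = 1 / (x * y) + u * (x * y)"
      by (simp only: n power_add power_one_over times_divide_times_eq mult_1_left)
    moreover have "(1 - y) * (1 - u * (x\<^sup>2 * y)) =
        (1 / (x * y) + u * (x * y) - (1 / x + u * x)) * (x * y)"
      using \<open>x \<noteq> 0\<close> \<open>y \<noteq> 0\<close> by (simp add: field_simps power2_eq_square)
    ultimately have "(1 - y) * (1 - u * (x\<^sup>2 * y)) = 0"
      by simp
    moreover have "x\<^sup>2 * y = q ^ (m + m + Suc d)"
      by (simp only: x_def y_def power2_eq_square power_add)
    moreover have "m + m + Suc d = Suc (2 * m + d)"
      by simp
    ultimately have "(1 - q ^ Suc d) * (1 - u * q ^ Suc (2 * m + d)) = 0"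
      by (simp only: y_def)
    moreover have "norm (q ^ Suc d) < 1"
      using power_Suc_less_one[of "norm q" d] assms(1,2) by (simp only: norm_power) simp
    ultimately show False
      using assms(3)[of "2 * m + d"] by auto
  qed
qed

lemma M_commute_generic:
  fixes q t u :: complex and v :: "complex fps"
  assumes G: "\<And>k. G (Suc k) * (1 - q ^ Suc k) = G k * (1 - t * q ^ k)"
    and v: "(1 - fps_const (q / t) * fps_X) * fps_scale q v = (1 - fps_const t * fps_X) * v"
    and q: "q \<noteq> 0" "norm q < 1" and t: "t \<noteq> 0"
    and A: "\<And>i. A * q ^ Suc i \<noteq> 1" "\<And>i. A' * q ^ Suc i \<noteq> 1"
    and B: "\<And>i. B * q ^ Suc i \<noteq> 1" "\<And>i. B' * q ^ Suc i \<noteq> 1"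
    and AB: "A * A' = B * B'" and u: "\<And>k. t * A * A' * q ^ Suc k \<noteq> 1"
  defines "M \<equiv> \<lambda>A A' f. (1 - fps_X) * v * K_op q t G A A' f"
  shows "M A A' (M B B' f) = M B B' (M A A' f)"
proof -
  define u where "u = t * A * A'"
  define iX where "iX = (inverse (1 - fps_X) :: complex fps)"
  \<comment> \<open>The inverse of 1 - X compensates for the linear factor that
    \<open>K_D_intertwine\<close> leaves on opposite sides.\<close>
  define L where "L f = D_op q (q / t) u (iX * f)" for f
  have iX: "iX * (1 - fps_X) = 1"
    unfolding iX_def by (rule inverse_mult_eq_1) simp
  have comm: "M C C' (L f) = L (M C C' f)"
    if C: "\<And>i. C * q ^ Suc i \<noteq> 1" "\<And>i. C' * q ^ Suc i \<noteq> 1" "u = t * C * C'" for C C' f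
  proof -
    have "M C C' (L f) = v * ((1 - fps_X) * K_op q t G C C' (D_op q (q / t) u (iX * f)))"
      by (simp only: M_def L_def mult_ac)
    also have "(1 - fps_X) * K_op q t G C C' (D_op q (q / t) u (iX * f)) =
        D_op q t u (K_op q t G C C' ((1 - fps_X) * (iX * f)))"
      unfolding C(3) by (rule K_D_intertwine[OF G C(1,2) q(1) t])
    also have "(1 - fps_X) * (iX * f) = f"
      using iX by (metis mult.assoc mult.commute mult_1)
    also have "v * D_op q t u (K_op q t G C C' f) = D_op q (q / t) u (v * K_op q t G C C' f)"
      by (rule D_op_mult[OF v q(1), symmetric])
    also have "v * K_op q t G C C' f = iX * M C C' f"
      unfolding M_def using iX by (metis mult.assoc mult_1)
    finally show ?thesis
      by (simp only: L_def)
  qed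
  have M: "causal (M C C')" for C C'
    unfolding M_def by (rule causal_mult[OF causal_K])
  \<comment> \<open>Multiplication by \<open>iX\<close> has unit diagonal, so \<open>L\<close>
    inherits the diagonal of \<open>D_op\<close>.\<close>
  have "fps_nth (L (fps_X ^ m)) m = (1 / q) ^ m + u * q ^ m" for m
  proof (cases m)
    case 0
    then show ?thesis by (simp add: L_def D_op_nth_0 iX_def)
  next
    case (Suc n)
    have "fps_nth (iX * fps_X ^ Suc n) n = 0" "fps_nth (iX * fps_X ^ Suc n) (Suc n) = 1"
      unfolding fps_X_power_mult_right_nth by (simp_all add: iX_def)
    then show ?thesis
      unfolding Suc L_def D_op_nth_Suc by simp
  qed
  then have "inj (\<lambda>m. fps_nth (L (fps_X ^ m)) m)"
    using eigenvalues_distinct[OF q(2,1), of u] u by (simp only: u_def) blast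
  moreover have "causal L"
    unfolding L_def by (rule causal_comp[OF causal_D causal_mult[OF causal_id]])
  moreover have "u = t * B * B'"
    using AB by (simp add: u_def mult.assoc)
  ultimately show ?thesis
    by (intro causal_commute[of "M A A'" "M B B'" L] M comm A B) (simp_all only: u_def)
qed

section \<open>Laurent coefficients of the kernel\<close>

lemma has_sum_powi_shift:
  fixes c :: "int \<Rightarrow> complex"
  assumes "((\<lambda>n. c n * w powi n) has_sum S) UNIV" "w \<noteq> 0"
  shows "((\<lambda>n. c (n + k) * w powi n) has_sum w powi (-k) * S) UNIV"
proof -
  have "((\<lambda>n. w powi (-k) * (c n * w powi n)) has_sum w powi (-k) * S) UNIV"
    by (rule has_sum_cmult_right[OF assms(1)])
  also have "?this \<longleftrightarrow> ?thesis"
    by (rule has_sum_reindex_bij_witness[where i = "\<lambda>n. n + k" and j = "\<lambda>n. n - k"])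
       (use assms(2) in \<open>auto simp: power_int_diff power_int_minus field_simps\<close>)
  finally show ?thesis .
qed

text \<open>Since q = x * (qh * th), the numerator of g(1/w) equals the factor (q/(xw);q) of the
  theta function below it. The two cancel off isolated points, and what remains is holomorphic on
  the annulus.\<close>

lemma remove_sings_kern:
  fixes q qh th a w :: complex
  defines "x \<equiv> qh / th"
  assumes q: "norm q < 1" and x: "q = x * (qh * th)" "x \<noteq> 0" "q \<noteq> 0" and a: "a \<noteq> 0"
    and w: "norm x < norm w" "norm w < 1 / norm x"
  shows "remove_sings (kern q qh th a) w =
    qpoch (a * x * w) q / qpoch (x * w) q * (qpoch (q / (a * x) * (1 / w)) q / qpoch (x * (1 / w)) q)"
    (is "_ = ?F w")
proof (rule remove_sings_eqI)
  define S :: "complex set" where "S = {w. norm x < norm w \<and> norm w < 1 / norm x}"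
  have S: "w' \<noteq> 0" "norm (x * w') < 1" "norm (x * (1 / w')) < 1" if "w' \<in> S" for w' :: complex
  proof -
    have "0 < norm w'"
      using that norm_ge_zero[of x] by (auto simp: S_def)
    then show "w' \<noteq> 0" "norm (x * w') < 1" "norm (x * (1 / w')) < 1"
      using that x(2) by (auto simp: S_def norm_mult norm_divide field_simps)
  qed
  have "open S"
    unfolding S_def by (intro open_Collect_conj open_Collect_less continuous_intros)
  have "?F holomorphic_on S"
    by (intro holomorphic_intros q qpoch_nonzero_ball S)
  then have "continuous_on S ?F"
    by (rule holomorphic_on_imp_continuous_on)
  moreover have "w \<in> S"
    using w by (simp add: S_def)
  ultimately have "isCont ?F w"
    using continuous_on_eq_continuous_at[OF \<open>open S\<close>] by blast
  moreover have "\<forall>\<^sub>F w' in at w. ?F w' = kern q qh th a w'"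
  proof -
    have "w \<noteq> 0" using S(1)[of w] w by (simp add: S_def)
    have ev0: "\<forall>\<^sub>F w' in at w. w' \<noteq> 0"
      by (rule eventually_neq_at_within)
    have "filterlim (\<lambda>w'. q / (x * w')) (at (q / (x * w))) (at w)"
      unfolding filterlim_at
    proof
      show "((\<lambda>w'. q / (x * w')) \<longlongrightarrow> q / (x * w)) (at w)"
        using x \<open>w \<noteq> 0\<close> by (intro tendsto_intros) auto
      show "\<forall>\<^sub>F w' in at w. q / (x * w') \<in> UNIV \<and> q / (x * w') \<noteq> q / (x * w)"
        using ev0 eventually_neq_at_within[of w w UNIV]
        by eventually_elim (use x \<open>w \<noteq> 0\<close> in \<open>simp add: divide_simps\<close>)
    qed
    then have "\<forall>\<^sub>F w' in at w. qpoch (q / (x * w')) q \<noteq> 0"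
      by (rule eventually_compose_filterlim[OF eventually_qpoch_nonzero[OF q]])
    with ev0 show ?thesis
    proof eventually_elim
      case (elim w')
      have e: "qh * th * (1 / w') = q / (x * w')" "q / (a * x) * (1 / w') = q / (a * x * w')"
        using x elim(1) by (simp_all add: field_simps)
      have "qpoch q q \<noteq> 0"
        by (rule qpoch_nonzero_ball[OF q q])
      with elim(2) show ?case
        unfolding kern_def g_fun_def theta_def x_def[symmetric] e by (simp add: divide_simps)
    qed
  qed
  ultimately show "(kern q qh th a \<longlongrightarrow> ?F w) (at w)"
    unfolding isCont_def by (rule Lim_transform_eventually)
qed

text \<open>Justifies the definite description: the product expansion gives existence, and the unit
  circle, which lies in the annulus because |x| < 1, gives uniqueness.\<close>

lemma kern_coeff_has_sum:
  fixes q qh th a :: complex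
  defines "x \<equiv> qh / th"
  assumes q: "norm q < 1" and x: "q = x * (qh * th)" "x \<noteq> 0" "q \<noteq> 0" "norm x < 1" and a: "a \<noteq> 0"
    and w: "norm x < norm w" "norm w < 1 / norm x"
  shows "((\<lambda>n. kern_coeff q qh th a n * w powi n) has_sum
    qpoch (a * x * w) q / qpoch (x * w) q * (qpoch (q / (a * x) * (1 / w)) q / qpoch (x * (1 / w)) q)) UNIV"
proof -
  define P where "P w = qpoch (a * x * w) q / qpoch (x * w) q" for w
  define N where "N w = qpoch (q / (a * x) * w) q / qpoch (x * w) q" for w
  have ball: "norm (x * w) < 1" if "w \<in> ball 0 (1 / norm x)" for w
    using that x(2) by (simp add: norm_mult field_simps)
  have "P holomorphic_on ball 0 (1 / norm x)" "N holomorphic_on ball 0 (1 / norm x)"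
    unfolding P_def N_def by (intro holomorphic_on_qpoch_quotient q ball; assumption)+
  then obtain c where c: "\<And>w. w \<noteq> 0 \<Longrightarrow> norm w < 1 / norm x \<Longrightarrow> norm (1 / w) < 1 / norm x \<Longrightarrow>
    ((\<lambda>n. c n * w powi n) has_sum P w * N (1 / w)) UNIV"
    using laurent_expansion_product by blast
  have thx: "norm (th / qh) = 1 / norm x"
    by (simp add: x_def norm_divide)
  have rs: "remove_sings (kern q qh th a) w = P w * N (1 / w)" if "norm x < norm w" "norm w < 1 / norm x" for w
    unfolding P_def N_def
    by (rule remove_sings_kern[OF q x(1-3)[unfolded x_def] a, folded x_def]) fact+
  have c': "((\<lambda>n. c n * w powi n) has_sum remove_sings (kern q qh th a) w) UNIV"
    if "norm x < norm w" "norm w < 1 / norm x" for w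
  proof -
    have "0 < norm w"
      using that(1) norm_ge_zero[of x] by linarith
    then show ?thesis
      unfolding rs[OF that] using that x(2) by (intro c) (auto simp: norm_divide field_simps)
  qed
  have "kern_coeff q qh th a = c"
    unfolding kern_coeff_def annulus_laurent_coeffs_def x_def[symmetric] thx
  proof (rule the_equality)
    show "\<forall>w. norm x < norm w \<and> norm w < 1 / norm x \<longrightarrow>
        ((\<lambda>n. c n * w powi n) has_sum remove_sings (kern q qh th a) w) UNIV"
      using c' by blast
  next
    fix d
    assume d: "\<forall>w. norm x < norm w \<and> norm w < 1 / norm x \<longrightarrow>
        ((\<lambda>n. d n * w powi n) has_sum remove_sings (kern q qh th a) w) UNIV"
    show "d = c"
    proof
      fix n
      show "d n = c n"
        by (rule laurent_coeffs_unique[of 1 d "remove_sings (kern q qh th a)" c])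
           (use d c' x(2,4) in simp_all)
    qed
  qed
  with c'[OF w] rs[OF w] show ?thesis
    unfolding P_def N_def by simp
qed

text \<open>Multiplying the kernel by \<open>1 - xw\<close> or by \<open>1 - x/w\<close> removes the pole on one side of the annulus, so
  the two products can be compared along \<open>w \<mapsto> qw\<close>, although the annulus itself need not meet
  its dilation by \<open>q\<close>.\<close>

lemma kern_coeff_step:
  fixes q qh th a :: complex
  defines "x \<equiv> qh / th"
  assumes q: "norm q < 1" and x: "q = x * (qh * th)" "x \<noteq> 0" "q \<noteq> 0" "norm x < 1" and a: "a \<noteq> 0"
  shows "kern_coeff q qh th a (n + 1) * (1 - a * x\<^sup>2 * q powi n) =
         x * kern_coeff q qh th a n * (1 - a * q powi n)"
proof -
  define c where "c = kern_coeff q qh th a"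
  define P where "P w = qpoch (a * x * w) q / qpoch (x * w) q" for w
  define N where "N w = qpoch (q / (a * x) * w) q / qpoch (x * w) q" for w
  define P1 where "P1 w = qpoch (a * x * w) q / qpoch (x * q * w) q" for w
  define N1 where "N1 w = qpoch (q / (a * x) * w) q / qpoch (x * q * w) q" for w
  have step: "qpoch (b * w) q = (1 - b * w) * qpoch (b * q * w) q" for b w
    using qpoch_step[OF q, of "b * w"] by (simp add: mult_ac)
  have c: "((\<lambda>n. c n * w powi n) has_sum P w * N (1 / w)) UNIV" if "norm w = 1" for w
    unfolding c_def P_def N_def
    by (rule kern_coeff_has_sum[OF q x[unfolded x_def] a, folded x_def])
       (use that x(2,4) in simp_all)
  have ball: "norm (x * w) < 1" if "w \<in> ball 0 (1 / norm x)" for w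
    using that x(2) by (simp add: norm_mult field_simps)
  have ball': "norm (x * q * w) < 1" if "w \<in> ball 0 (1 / norm (x * q))" for w
    using that x(2,3) by (simp add: norm_mult field_simps)
  have hol: "P holomorphic_on ball 0 (1 / norm x)" "N holomorphic_on ball 0 (1 / norm x)"
    "P1 holomorphic_on ball 0 (1 / norm (x * q))" "N1 holomorphic_on ball 0 (1 / norm (x * q))"
    unfolding P_def N_def P1_def N1_def
    by (intro holomorphic_on_qpoch_quotient q ball ball'; assumption)+
  have "norm x * norm q < 1"
    using mult_strict_mono[OF x(4) q] by simp
  \<comment> \<open>The first two bounds place the unit circle in both enlarged annuli; the last two
    place the circle of radius |q| in that of \<open>P\<close> and \<open>N1\<close>.\<close>
  then have big: "1 < 1 / norm (x * q)" "1 < 1 / norm x" "1 / norm q < 1 / norm (x * q)" "norm q < 1 / norm x"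
    using x q by (auto simp: norm_mult field_simps)
  obtain d where d: "\<And>w. w \<noteq> 0 \<Longrightarrow> norm w < 1 / norm (x * q) \<Longrightarrow> norm (1 / w) < 1 / norm x \<Longrightarrow>
    ((\<lambda>n. d n * w powi n) has_sum P1 w * N (1 / w)) UNIV"
    using laurent_expansion_product[OF hol(3,2)] by blast
  obtain e where e: "\<And>w. w \<noteq> 0 \<Longrightarrow> norm w < 1 / norm x \<Longrightarrow> norm (1 / w) < 1 / norm (x * q) \<Longrightarrow>
    ((\<lambda>n. e n * w powi n) has_sum P w * N1 (1 / w)) UNIV"
    using laurent_expansion_product[OF hol(1,4)] by blast
  have nz: "w \<noteq> 0" "1 - x * w \<noteq> 0" "1 - x * (1 / w) \<noteq> 0" if "norm w = 1" for w
  proof -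
    have "norm (x * w) \<noteq> 1" "norm (x * (1 / w)) \<noteq> 1"
      using that x(4) by (simp_all add: norm_mult norm_divide)
    then show "1 - x * w \<noteq> 0" "1 - x * (1 / w) \<noteq> 0" by auto
    show "w \<noteq> 0" using that by auto
  qed
  have d_eq: "d n = c n - x * c (n + (-1))" for n
  proof (rule laurent_coeffs_unique[of 1 d "\<lambda>w. P1 w * N (1 / w)" "\<lambda>n. c n - x * c (n + (-1))"])
    fix w :: complex assume w: "norm w = 1"
    note w0 = nz[OF w]
    show "((\<lambda>n. d n * w powi n) has_sum P1 w * N (1 / w)) UNIV"
      using w w0(1) big by (intro d) (simp_all add: norm_divide)
    have P1: "P1 w = (1 - x * w) * P w"
      unfolding P_def P1_def step[of x] using w0(2) by simp
    have "((\<lambda>n. c n * w powi n - x * (c (n + (-1)) * w powi n)) has_sum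
             (P w * N (1 / w) - x * (w powi (-(-1)) * (P w * N (1 / w))))) UNIV"
      using has_sum_add[OF c[OF w] has_sum_uminusI[OF has_sum_cmult_right[OF
            has_sum_powi_shift[OF c[OF w] w0(1), of "-1"], of x]]]
      by (simp only: diff_conv_add_uminus)
    then show "((\<lambda>n. (c n - x * c (n + (-1))) * w powi n) has_sum P1 w * N (1 / w)) UNIV"
      unfolding P1 by (simp add: algebra_simps)
  qed simp
  have e_eq: "e n = c n - x * c (n + 1)" for n
  proof (rule laurent_coeffs_unique[of 1 e "\<lambda>w. P w * N1 (1 / w)" "\<lambda>n. c n - x * c (n + 1)"])
    fix w :: complex assume w: "norm w = 1"
    note w0 = nz[OF w]
    show "((\<lambda>n. e n * w powi n) has_sum P w * N1 (1 / w)) UNIV"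
      using w w0(1) big by (intro e) (simp_all add: norm_divide)
    have N1: "N1 (1 / w) = (1 - x * (1 / w)) * N (1 / w)"
    proof -
      have "b / b' = r * (b / (r * b'))" if "r \<noteq> 0" for b b' r :: complex
        using that by simp
      from this[OF w0(3)] show ?thesis
        unfolding N_def N1_def step[of x] .
    qed
    have "((\<lambda>n. c n * w powi n - x * (c (n + 1) * w powi n)) has_sum
             (P w * N (1 / w) - x * (w powi (-1) * (P w * N (1 / w))))) UNIV"
      using has_sum_add[OF c[OF w] has_sum_uminusI[OF has_sum_cmult_right[OF
            has_sum_powi_shift[OF c[OF w] w0(1), of 1], of x]]]
      by (simp only: diff_conv_add_uminus)
    then show "((\<lambda>n. (c n - x * c (n + 1)) * w powi n) has_sum P w * N1 (1 / w)) UNIV"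
      unfolding N1 by (simp add: algebra_simps power_int_minus divide_inverse)
  qed simp
  \<comment> \<open>Evaluate the e-series at qw and the d-series at w, with |w| = 1. The dilation
    produces 1 - axw and 1 - 1/(axw), whose ratio accounts for the factor -1/(axw).\<close>
  have "e n * q powi n = - 1 / (a * x) * d (n + 1)" for n
  proof (rule laurent_coeffs_unique[of 1 "\<lambda>n. e n * q powi n"
        "\<lambda>w. - 1 / (a * x) * (w powi (-1) * (P1 w * N (1 / w)))" "\<lambda>n. - 1 / (a * x) * d (n + 1)"])
    fix w :: complex assume w: "norm w = 1"
    note w0 = nz[OF w]
    have P1: "P1 w = (1 - a * x * w) * P (q * w)"
      unfolding P_def P1_def step[of "a * x" w] by (simp add: mult_ac)
    have N1: "N1 (1 / (q * w)) = (1 - 1 / (a * x) * (1 / w)) * N (1 / w)"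
    proof -
      have "q / (a * x) * (1 / (q * w)) = 1 / (a * x) * (1 / w)" "x * q * (1 / (q * w)) = x * (1 / w)"
        using x(3) by simp_all
      then show ?thesis
        unfolding N_def N1_def using step[of "1 / (a * x)" "1 / w"] by simp
    qed
    have "P (q * w) * N1 (1 / (q * w)) = - 1 / (a * x) * (w powi (-1) * (P1 w * N (1 / w)))"
      unfolding P1 N1 using a x(2) w0(1) by (simp add: field_simps power_int_minus)
    moreover have "((\<lambda>n. e n * (q * w) powi n) has_sum P (q * w) * N1 (1 / (q * w))) UNIV"
      using w w0(1) x(3) big by (intro e) (simp_all add: norm_divide norm_mult)
    ultimately show "((\<lambda>n. e n * q powi n * w powi n) has_sum - 1 / (a * x) * (w powi (-1) * (P1 w * N (1 / w)))) UNIV"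
      by (simp add: power_int_mult_distrib mult.assoc)
    have "((\<lambda>n. d n * w powi n) has_sum P1 w * N (1 / w)) UNIV"
      using w w0(1) big by (intro d) (simp_all add: norm_divide)
    from has_sum_cmult_right[OF has_sum_powi_shift[OF this w0(1), of 1], of "- 1 / (a * x)"]
    show "((\<lambda>n. - 1 / (a * x) * d (n + 1) * w powi n) has_sum - 1 / (a * x) * (w powi (-1) * (P1 w * N (1 / w)))) UNIV"
      by (simp only: mult.assoc)
  qed simp
  then have "(c n - x * c (n + 1)) * q powi n = - 1 / (a * x) * (c (n + 1) - x * c n)"
    unfolding d_eq e_eq by simp
  then have "a * x * ((c n - x * c (n + 1)) * q powi n) = - (c (n + 1) - x * c n)"
    using a x(2) by simp
  then show ?thesis
    unfolding c_def[symmetric] by (simp add: algebra_simps power2_eq_square)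
qed

section \<open>One-sided product formulas for the kernel coefficients\<close>

lemma kern_coeff_nonneg:
  fixes q t qh th a :: complex
  defines "x \<equiv> qh / th"
  assumes q: "norm q < 1" and x: "q = x * (qh * th)" "x \<noteq> 0" "q \<noteq> 0" "norm x < 1" and a: "a \<noteq> 0"
    and t: "x\<^sup>2 = q / t" "t \<noteq> 0" and gen: "\<And>i. a / t * q ^ Suc i \<noteq> 1"
  shows "kern_coeff q qh th a (int k) = kern_coeff q qh th a 0 * x ^ k * qratio q t (a / t) k"
proof (induction k)
  case (Suc k)
  have "kern_coeff q qh th a (int k + 1) * (1 - a * x\<^sup>2 * q powi int k) =
        x * kern_coeff q qh th a (int k) * (1 - a * q powi int k)"
    by (rule kern_coeff_step[OF q x[unfolded x_def] a, folded x_def])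
  then have "kern_coeff q qh th a (int (Suc k)) * (1 - a / t * q ^ Suc k) =
        x * kern_coeff q qh th a (int k) * (1 - t * (a / t) * q ^ k)"
    using t by (simp add: add.commute mult.assoc)
  then have "kern_coeff q qh th a (int (Suc k)) =
        x * kern_coeff q qh th a (int k) * (1 - t * (a / t) * q ^ k) / (1 - a / t * q ^ Suc k)"
    using gen[of k] by (metis eq_divide_eq right_minus_eq)
  then show ?case
    unfolding Suc.IH qratio_Suc by (simp add: mult_ac)
qed (simp add: qratio_def)

text \<open>The recurrence is run downwards. Multiplying by -p/(ax) with p = q^(k+1) turns 1 - a/p
  into 1 - p/a, so the same ratio appears as on the other side, with 1/a in place of a/t.\<close>

lemma kern_coeff_nonpos:
  fixes q t qh th a :: complex
  defines "x \<equiv> qh / th"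
  assumes q: "norm q < 1" and x: "q = x * (qh * th)" "x \<noteq> 0" "q \<noteq> 0" "norm x < 1" and a: "a \<noteq> 0"
    and t: "x\<^sup>2 = q / t" "t \<noteq> 0" and gen: "\<And>i. 1 / a * q ^ Suc i \<noteq> 1"
  shows "kern_coeff q qh th a (- int k) = kern_coeff q qh th a 0 * x ^ k * qratio q t (1 / a) k"
proof (induction k)
  case (Suc k)
  define p where "p = q ^ Suc k"
  have p: "p \<noteq> 0" "q powi (- int (Suc k)) = 1 / p"
    using x by (simp_all add: p_def power_int_minus divide_inverse del: power_Suc of_nat_Suc)
  have "kern_coeff q qh th a (- int (Suc k) + 1) * (1 - a * x\<^sup>2 * q powi (- int (Suc k))) =
        x * kern_coeff q qh th a (- int (Suc k)) * (1 - a * q powi (- int (Suc k)))"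
    by (rule kern_coeff_step[OF q x[unfolded x_def] a, folded x_def])
  then have *: "kern_coeff q qh th a (- int k) * (1 - a * x\<^sup>2 * (1 / p)) =
        x * kern_coeff q qh th a (- int (Suc k)) * (1 - a * (1 / p))"
    unfolding p(2) by simp
  have "kern_coeff q qh th a (- int (Suc k)) * (1 - 1 / a * p) =
        kern_coeff q qh th a (- int k) * (x - 1 / a * p / x)"
  proof -
    have "y * (1 - 1 / a * p) = - (p / (a * x)) * (x * y * (1 - a * (1 / p)))"
      and "y * (x - 1 / a * p / x) = - (p / (a * x)) * (y * (1 - a * x\<^sup>2 * (1 / p)))" for y
      using a p(1) x(2) by (simp_all add: field_simps power2_eq_square)
    with * show ?thesis by simp
  qed
  also have "x - 1 / a * p / x = x * (1 - t * (1 / a) * q ^ k)"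
  proof -
    have "p / x = x * (t * q ^ k)"
      using t x(2,3) by (simp add: p_def field_simps power2_eq_square)
    then have "1 / a * p / x = x * (t * (1 / a) * q ^ k)"
      using a x(2) by (simp add: field_simps)
    then show ?thesis
      by (simp add: right_diff_distrib)
  qed
  finally have "kern_coeff q qh th a (- int (Suc k)) =
        kern_coeff q qh th a (- int k) * (x * (1 - t * (1 / a) * q ^ k)) / (1 - 1 / a * q ^ Suc k)"
    using gen[of k] unfolding p_def by (metis eq_divide_eq right_minus_eq)
  then show ?case
    unfolding Suc.IH qratio_Suc by (simp add: mult_ac)
qed (simp add: qratio_def)

section \<open>Commutation\<close>

lemma h_fun_expansion:
  assumes "norm q < 1"
  shows "fps_expansion (h_fun q t) 0 =
    (1 - fps_X) * fps_expansion (\<lambda>z. qpoch (q / t * z) q / qpoch (t * z) q) 0"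
proof (rule fps_expansion_eqI)
  have "(\<lambda>z. (1 - z) * (qpoch (q / t * z) q / qpoch (t * z) q)) has_fps_expansion
    (1 - fps_X) * fps_expansion (\<lambda>z. qpoch (q / t * z) q / qpoch (t * z) q) 0"
    by (intro fps_expansion_intros has_fps_expansion_qpoch_quotient assms)
  then show "h_fun q t has_fps_expansion
    (1 - fps_X) * fps_expansion (\<lambda>z. qpoch (q / t * z) q / qpoch (t * z) q) 0"
    by (simp add: h_fun_def[abs_def])
qed

text \<open>The constant term pairs nonpositive indices of the first kernel with nonnegative indices
  of the second. Hence the asymmetric parameters s1/\<alpha> and \<alpha>/(s2 t).\<close>

lemma monomial_terms_diagonal:
  "(k, n, a, b, j) \<in> monomial_terms (- int m) (int m) 0 0 \<longleftrightarrow>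
     j \<le> m \<and> a \<le> m - j \<and> b = m - j - a \<and> k = - int (j + (m - j - a)) \<and> n = int (j + a)"
  by (auto simp: monomial_terms_def)

lemma product_coeff_diagonal:
  "product_coeff A B C D f (- int m) (int m) 0 0 =
     (\<Sum>j\<le>m. (\<Sum>a\<le>m - j. A (- int (j + (m - j - a))) * B (int (j + a)) *
        fps_nth C a * fps_nth D (m - j - a)) * fps_nth f j)"
proof -
  have "product_coeff A B C D f (- int m) (int m) 0 0 =
     (\<Sum>(j, a)\<in>Sigma {..m} (\<lambda>j. {..m - j}). A (- int (j + (m - j - a))) * B (int (j + a)) *
        fps_nth C a * fps_nth D (m - j - a) * fps_nth f j)"
    unfolding product_coeff_def
    by (rule sum.reindex_bij_witness[where j = "\<lambda>(m1, n, a, b, j). (j, a)" and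
          i = "\<lambda>(j, a). (- int (j + (m - j - a)), int (j + a), a, m - j - a, j)"])
       (auto simp: monomial_terms_diagonal)
  then show ?thesis
    by (simp add: sum.Sigma[symmetric] sum_distrib_right)
qed

lemma I_op_eq:
  fixes q t qh th s1 s2 \<alpha> :: complex
  assumes q: "norm q < 1" "q \<noteq> 0" and qt: "norm (q / t) < 1" "t \<noteq> 0"
    and sq: "qh ^ 2 = q" "th ^ 2 = t" and s: "s1 \<noteq> 0" "s2 \<noteq> 0" and \<alpha>: "\<alpha> \<noteq> 0"
    and A: "\<And>i. s1 / \<alpha> * q ^ Suc i \<noteq> 1" and A': "\<And>i. \<alpha> / s2 / t * q ^ Suc i \<noteq> 1"
  shows "\<exists>c. \<forall>f. I_op q t qh th s1 s2 \<alpha> f = fps_const c *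
    ((1 - fps_X) * fps_expansion (\<lambda>z. qpoch (q / t * z) q / qpoch (t * z) q) 0 *
     K_op q t (\<lambda>k. fps_nth (fps_expansion (g_fun q qh th) 0) k / (qh / th) ^ k) (s1 / \<alpha>) (\<alpha> / s2 / t) f)"
proof -
  define x where "x = qh / th"
  have nz: "qh \<noteq> 0" "th \<noteq> 0"
    using q qt sq by auto
  have x2: "x\<^sup>2 = q / t"
    by (simp add: x_def power_divide sq)
  have xq: "q = x * (qh * th)" "x \<noteq> 0"
    using nz sq(1) by (simp_all add: x_def power2_eq_square)
  have x1: "norm x < 1"
    using qt(1) unfolding x2[symmetric] norm_power by (simp add: power_less_one_iff abs_square_less_1)
  define a1 where "a1 = kern_coeff q qh th (\<alpha> / s1) 0"
  define a2 where "a2 = kern_coeff q qh th (\<alpha> / s2) 0"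
  define gs where "gs = fps_expansion (g_fun q qh th) 0"
  \<comment> \<open>Dividing by x^k removes x from the recurrence of the coefficients of
    \<open>g\<close>.\<close>
  define G where "G k = fps_nth gs k / x ^ k" for k
  have g: "fps_nth gs k = x ^ k * G k" for k
    using xq(2) by (simp add: G_def)
  have c1: "kern_coeff q qh th (\<alpha> / s1) (- int k) = a1 * x ^ k * qratio q t (s1 / \<alpha>) k" for k
    using kern_coeff_nonpos[OF q(1) xq[unfolded x_def] q(2) x1[unfolded x_def], of "\<alpha> / s1" t k]
      x2 qt(2) A s \<alpha> by (simp add: a1_def x_def)
  have c2: "kern_coeff q qh th (\<alpha> / s2) (int k) = a2 * x ^ k * qratio q t (\<alpha> / s2 / t) k" for k
    unfolding a2_def x_def
    by (rule kern_coeff_nonneg[OF q(1) xq[unfolded x_def] q(2) x1[unfolded x_def]])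
       (use s \<alpha> x2 qt(2) A' in \<open>simp_all add: x_def\<close>)
  have "product_coeff (kern_coeff q qh th (\<alpha> / s1)) (kern_coeff q qh th (\<alpha> / s2)) gs gs f (- int m) (int m) 0 0 =
        a1 * a2 * fps_nth (K_op q t G (s1 / \<alpha>) (\<alpha> / s2 / t) f) m" for f m
  proof -
    have "a1 * x ^ (j + (m - j - a)) * r (j + (m - j - a)) * (a2 * x ^ (j + a) * r' (j + a)) *
           (x ^ a * G a) * (x ^ (m - j - a) * G (m - j - a)) =
          a1 * a2 * (q / t) ^ m * (G a * G (m - j - a) * r (j + (m - j - a)) * r' (j + a))"
      if "j \<le> m" "a \<le> m - j" for j a and r r' :: "nat \<Rightarrow> complex"
    proof -
      \<comment> \<open>The powers of x from both kernels and both factors \<open>g\<close> have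
        total exponent 2m whatever j and a are.\<close>
      have "(q / t) ^ m = x ^ (2 * m)"
        unfolding x2[symmetric] by (rule power_mult[symmetric])
      also have "2 * m = (j + (m - j - a)) + (j + a) + a + (m - j - a)"
        using that by simp
      finally show ?thesis
        unfolding power_add by (simp only: mult_ac)
    qed
    then have "(\<Sum>a\<le>m - j. a1 * x ^ (j + (m - j - a)) * r (j + (m - j - a)) * (a2 * x ^ (j + a) * r' (j + a)) *
           (x ^ a * G a) * (x ^ (m - j - a) * G (m - j - a))) = a1 * a2 * ((q / t) ^ m * conv_sum G r r' (m - j) j)"
      if "j \<le> m" for j and r r' :: "nat \<Rightarrow> complex"
      unfolding conv_sum_def sum_distrib_left using that
      by (intro sum.cong refl) (simp only: atMost_iff mult.assoc)
    then show ?thesis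
      unfolding product_coeff_diagonal K_op_def fps_nth_Abs_fps c1 c2 g sum_distrib_left
      by (intro sum.cong refl) (simp only: atMost_iff mult.assoc)
  qed
  then have "Abs_fps (\<lambda>m. product_coeff (kern_coeff q qh th (\<alpha> / s1)) (kern_coeff q qh th (\<alpha> / s2)) gs gs f
      (- int m) (int m) 0 0) = fps_const (a1 * a2) * K_op q t G (s1 / \<alpha>) (\<alpha> / s2 / t) f" for f
    by (intro fps_ext) simp
  then have "I_op q t qh th s1 s2 \<alpha> f =
      fps_const (I_prefactor q t s1 \<alpha> * I_prefactor q t s2 \<alpha> * (a1 * a2)) *
      ((1 - fps_X) * fps_expansion (\<lambda>z. qpoch (q / t * z) q / qpoch (t * z) q) 0 *
       K_op q t G (s1 / \<alpha>) (\<alpha> / s2 / t) f)" for f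
    unfolding I_op_def gs_def[symmetric] h_fun_expansion[OF q(1)]
    by (simp only: fps_const_mult[symmetric] mult_ac)
  then show ?thesis
    unfolding G_def[abs_def] gs_def x_def by blast
qed

text \<open>The q-binomial recurrence with b = x and a = x t; thus G k = (t;q)_k / (q;q)_k.\<close>

lemma g_fun_coeff_step:
  fixes q t qh th :: complex
  assumes "norm q < 1" "qh \<noteq> 0" "th \<noteq> 0" "th ^ 2 = t"
  defines "G \<equiv> \<lambda>k. fps_nth (fps_expansion (g_fun q qh th) 0) k / (qh / th) ^ k"
  shows "G (Suc k) * (1 - q ^ Suc k) = G k * (1 - t * q ^ k)"
proof -
  define x where "x = qh / th"
  have x: "x \<noteq> 0" "qh * th = x * t"
    using assms(2-4) by (auto simp: x_def power2_eq_square)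
  have "fps_nth (fps_expansion (g_fun q qh th) 0) (Suc k) * (1 - q ^ Suc k) =
        fps_nth (fps_expansion (g_fun q qh th) 0) k * (x - x * t * q ^ k)"
    using fps_qpoch_quotient_nth_Suc[OF assms(1), of "qh * th" "qh / th" k]
    unfolding g_fun_def[abs_def] x_def[symmetric] x(2) .
  then have "G (Suc k) * (1 - q ^ Suc k) =
      fps_nth (fps_expansion (g_fun q qh th) 0) k * (x - x * t * q ^ k) / (x * x ^ k)"
    unfolding G_def x_def[symmetric] by simp
  also have "x - x * t * q ^ k = x * (1 - t * q ^ k)"
    by (simp add: right_diff_distrib)
  finally show ?thesis
    unfolding G_def x_def[symmetric] using x(1) by simp
qed

section \<open>Continuity in s1 and the general case\<close>

lemma tendsto_qratio:
  assumes "(f \<longlongrightarrow> A) F" "\<And>i. A * q ^ Suc i \<noteq> 1"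
  shows "((\<lambda>y. qratio q t (f y) n) \<longlongrightarrow> qratio q t A n) F"
  unfolding qratio_def
  by (intro tendsto_intros assms) (use assms(2) in auto)

text \<open>Every coefficient is a finite sum. The argument series may vary too, so that the
  statement can be nested for a composition.\<close>

lemma tendsto_K_op:
  assumes "(f \<longlongrightarrow> A) F" "\<And>i. A * q ^ Suc i \<noteq> 1" "\<And>n. ((\<lambda>y. fps_nth (g y) n) \<longlongrightarrow> fps_nth g0 n) F"
  shows "((\<lambda>y. fps_nth (p * K_op q t G (f y) A' (g y)) n) \<longlongrightarrow> fps_nth (p * K_op q t G A A' g0) n) F"
  unfolding fps_mult_nth K_op_def conv_sum_def fps_nth_Abs_fps
  by (intro tendsto_intros tendsto_qratio assms)

text \<open>Replace s1 by a nearby y. The product of the two parameters is y/(s2 t) for \<alpha> and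
  for \<beta>, so the generic case applies at almost every y, and the coefficients of both sides
  converge as y tends to s1.\<close>

lemma M_commute:
  fixes q t s1 s2 \<alpha> \<beta> :: complex and v :: "complex fps"
  assumes G: "\<And>k. G (Suc k) * (1 - q ^ Suc k) = G k * (1 - t * q ^ k)"
    and v: "(1 - fps_const (q / t) * fps_X) * fps_scale q v = (1 - fps_const t * fps_X) * v"
    and q: "q \<noteq> 0" "norm q < 1" and t: "t \<noteq> 0"
    and nz: "s2 \<noteq> 0" "\<alpha> \<noteq> 0" "\<beta> \<noteq> 0"
    and A: "\<And>i. s1 / \<alpha> * q ^ Suc i \<noteq> 1" "\<And>i. \<alpha> / s2 / t * q ^ Suc i \<noteq> 1"
    and B: "\<And>i. s1 / \<beta> * q ^ Suc i \<noteq> 1" "\<And>i. \<beta> / s2 / t * q ^ Suc i \<noteq> 1"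
  defines "M \<equiv> \<lambda>A A' f. (1 - fps_X) * v * K_op q t G A A' f"
  shows "M (s1 / \<alpha>) (\<alpha> / s2 / t) (M (s1 / \<beta>) (\<beta> / s2 / t) f) =
         M (s1 / \<beta>) (\<beta> / s2 / t) (M (s1 / \<alpha>) (\<alpha> / s2 / t) f)"
proof (rule fps_ext)
  fix n
  let ?L = "\<lambda>y. M (y / \<alpha>) (\<alpha> / s2 / t) (M (y / \<beta>) (\<beta> / s2 / t) f)"
  let ?R = "\<lambda>y. M (y / \<beta>) (\<beta> / s2 / t) (M (y / \<alpha>) (\<alpha> / s2 / t) f)"
  have ev: "\<forall>\<^sub>F y in at s1. \<forall>i. y / c * q ^ Suc i \<noteq> 1" if "c \<noteq> 0" for c
  proof -
    have "filterlim (\<lambda>y. y / c * q) (at (s1 / c * q)) (at s1)"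
      unfolding filterlim_at
    proof
      show "((\<lambda>y. y / c * q) \<longlongrightarrow> s1 / c * q) (at s1)"
        using that by (intro tendsto_intros)
      show "\<forall>\<^sub>F y in at s1. y / c * q \<in> UNIV \<and> y / c * q \<noteq> s1 / c * q"
        using eventually_neq_at_within[of s1 s1 UNIV]
        by eventually_elim (use that q in simp)
    qed
    then have "\<forall>\<^sub>F y in at s1. qpoch (y / c * q) q \<noteq> 0"
      by (rule eventually_compose_filterlim[OF eventually_qpoch_nonzero[OF q(2)]])
    then show ?thesis
      unfolding qpoch_nonzero_iff[OF q(2)] by (simp add: mult.assoc)
  qed
  have lim: "((\<lambda>y. fps_nth (M (y / b) b' (M (y / c) c' f)) n) \<longlongrightarrow>
      fps_nth (M (s1 / b) b' (M (s1 / c) c' f)) n) (at s1)"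
    if "b \<noteq> 0" "\<And>i. s1 / b * q ^ Suc i \<noteq> 1" "c \<noteq> 0" "\<And>i. s1 / c * q ^ Suc i \<noteq> 1" for b b' c c'
    unfolding M_def
    by (rule tendsto_K_op[OF _ that(2) tendsto_K_op[OF _ that(4) tendsto_const]])
       (use that(1,3) in \<open>auto intro!: tendsto_divide tendsto_ident_at tendsto_const\<close>)
  \<comment> \<open>The instance with s2 separates the eigenvalues; those with \<alpha> and \<beta>
    keep the denominators of \<open>qratio\<close> nonzero.\<close>
  have "\<forall>\<^sub>F y in at s1. fps_nth (?L y) n = fps_nth (?R y) n"
    using ev[OF nz(1)] ev[OF nz(2)] ev[OF nz(3)]
  proof eventually_elim
    case (elim y)
    have "t * (y / \<alpha>) * (\<alpha> / s2 / t) = y / s2"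
      using t nz by simp
    then have "t * (y / \<alpha>) * (\<alpha> / s2 / t) * q ^ Suc k \<noteq> 1" for k
      using elim(1) by (simp only: not_False_eq_True simp_thms)
    moreover have "y / \<alpha> * (\<alpha> / s2 / t) = y / \<beta> * (\<beta> / s2 / t)"
      using nz by simp
    ultimately show ?case
      unfolding M_def
      by (intro arg_cong[of _ _ "\<lambda>f. fps_nth f n"] M_commute_generic[OF G v q t])
         (use elim A(2) B(2) in blast)+
  qed
  then have "((\<lambda>y. fps_nth (?L y) n) \<longlongrightarrow> fps_nth (?R s1) n) (at s1)"
    using lim[OF nz(3) B(1) nz(2) A(1)] by (subst tendsto_cong)
  with lim[OF nz(2) A(1) nz(3) B(1)] show "fps_nth (?L s1) n = fps_nth (?R s1) n"
    by (intro tendsto_unique[of "at s1"]) auto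
qed

theorem theorem1p3:
  fixes q t qh th s1 s2 \<alpha> \<beta> :: complex
  assumes "norm q < 1" and "norm (q / t) < 1"
    and "qh ^ 2 = q" and "th ^ 2 = t"
    and "q \<noteq> 0" and "t \<noteq> 0" and "s1 \<noteq> 0" and "s2 \<noteq> 0"
    and "generic_alpha q t s1 s2 \<alpha>" and "generic_alpha q t s1 s2 \<beta>"
  shows "I_op q t qh th s1 s2 \<alpha> \<circ> I_op q t qh th s1 s2 \<beta> =
         I_op q t qh th s1 s2 \<beta> \<circ> I_op q t qh th s1 s2 \<alpha>"
proof -
  define v where "v = fps_expansion (\<lambda>z. qpoch (q / t * z) q / qpoch (t * z) q) 0"
  define G where "G = (\<lambda>k. fps_nth (fps_expansion (g_fun q qh th) 0) k / (qh / th) ^ k)"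
  define M where "M = (\<lambda>A A' f. (1 - fps_X) * v * K_op q t G A A' f)"
  have nz: "qh \<noteq> 0" "th \<noteq> 0" using assms(3-6) by auto
  have gen: "\<gamma> \<noteq> 0" "\<And>i. s1 / \<gamma> * q ^ Suc i \<noteq> 1" "\<And>i. \<gamma> / s2 / t * q ^ Suc i \<noteq> 1"
    if "generic_alpha q t s1 s2 \<gamma>" for \<gamma>
  proof -
    \<comment> \<open>The poles of the prefactor in \<gamma> are matched with the denominators of
      \<open>qratio\<close>: the first symbol with A = s1/\<gamma>, the second with A' =
      \<gamma>/(s2 t).\<close>
    have "qpoch (s1 / \<gamma> * q) q \<noteq> 0" "qpoch (\<gamma> / s2 * (q / t)) q \<noteq> 0"
      using that by (simp_all add: generic_alpha_def)
    then have *: "s1 / \<gamma> * q * q ^ i \<noteq> 1" "\<gamma> / s2 * (q / t) * q ^ i \<noteq> 1" for i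
      unfolding qpoch_nonzero_iff[OF assms(1)] by blast+
    show "s1 / \<gamma> * q ^ Suc i \<noteq> 1" for i
      using *(1)[of i] by (simp add: mult.assoc)
    show "\<gamma> / s2 / t * q ^ Suc i \<noteq> 1" for i
      using *(2)[of i] by (simp add: mult.assoc)
    show "\<gamma> \<noteq> 0"
      using that by (simp add: generic_alpha_def)
  qed
  have I: "\<exists>c. \<forall>f. I_op q t qh th s1 s2 \<gamma> f = fps_const c * M (s1 / \<gamma>) (\<gamma> / s2 / t) f"
    if \<gamma>: "generic_alpha q t s1 s2 \<gamma>" for \<gamma>
    unfolding M_def v_def G_def by (rule I_op_eq[OF assms(1,5,2,6,3,4,7,8) gen[OF \<gamma>]])
  obtain a where a: "\<And>f. I_op q t qh th s1 s2 \<alpha> f = fps_const a * M (s1 / \<alpha>) (\<alpha> / s2 / t) f"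
    using I[OF assms(9)] by blast
  obtain b where b: "\<And>f. I_op q t qh th s1 s2 \<beta> f = fps_const b * M (s1 / \<beta>) (\<beta> / s2 / t) f"
    using I[OF assms(10)] by blast
  have M: "causal (M A A')" for A A'
    unfolding M_def by (rule causal_mult[OF causal_K])
  have G: "G (Suc k) * (1 - q ^ Suc k) = G k * (1 - t * q ^ k)" for k
    unfolding G_def by (rule g_fun_coeff_step[OF assms(1) nz assms(4)])
  have v: "(1 - fps_const (q / t) * fps_X) * fps_scale q v = (1 - fps_const t * fps_X) * v"
    unfolding v_def fps_scale_def by (rule fps_qpoch_quotient_step[OF assms(1), symmetric])
  have "M (s1 / \<alpha>) (\<alpha> / s2 / t) (M (s1 / \<beta>) (\<beta> / s2 / t) f) =
        M (s1 / \<beta>) (\<beta> / s2 / t) (M (s1 / \<alpha>) (\<alpha> / s2 / t) f)" for f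
    unfolding M_def
    by (rule M_commute[OF G v assms(5,1,6,8) gen(1)[OF assms(9)] gen(1)[OF assms(10)]
          gen(2,3)[OF assms(9)] gen(2,3)[OF assms(10)]])
  then show ?thesis
    unfolding fun_eq_iff o_apply a b causal_cmult[OF M] by (simp only: mult.left_commute simp_thms)
qed

end
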